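(* Let $W(x)=I_px^N+A_{N-1}x^{N-1}+\dots+A_0\in\mathbb{R}^{p\times p}[x]$ be a monic matrix polynomial of degree $N\ge 1$, and let $\{P^{[1]}_k,P^{[2]}_k\}_{k\ge 0}$ and $\{\hat P^{[1]}_k,\hat P^{[2]}_k\}_{k\ge0}$ be the monic matrix bi-orthogonal polynomials associated with the matrices of measures $d\mu(x)$ and $W(x)d\mu(x)$, respectively, with matrix squared norms $H_k$ and $\hat H_k$. Let $\pi_k$, $\Pi_{k,N}$, $\gamma_k(x)$ be the matrices defined in the context in terms of the adapted root polynomials of $W$. Then for every $k\in\{0,1,2,\dots\}$ with $\det\Pi_{k,N}\neq0$, $$\hat P_k^{[1]}(x)W(x)=\Theta_*\left[\begin{array}{c|c}\Pi_{k,N}&\begin{matrix}P^{[1]}_k(x)\\ \vdots\\ P^{[1]}_{k+N-1}(x)\end{matrix}\\ \hline \pi_{k+N}&P^{[1]}_{k+N}(x)\end{array}\right],\qquad \hat H_k=\Theta_*\left[\begin{array}{c|c}\Pi_{k,N}&\begin{matrix}H_k\\0\\ \vdots\\0\end{matrix}\\ \hline \pi_{k+N}&0\end{array}\right],$$ and for every $k\in\{0,1,2,\dots\}$ with $\det\Pi_{k+1,N}\ne0$, $$(\hat P_k^{[2]}(x))^\top(\hat H_k)^{-1}=\Theta_*\left[\begin{array}{c|c}\Pi_{k+1,N}&\begin{matrix}0\\ \vdots\\0\\ I_p\end{matrix}\\ \hline \gamma_k(x)&0\end{array}\right].$$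
   Context: **Last quasideterminant.** For a block matrix with $A$ square and nonsingular, $\Theta_*\begin{bmatrix}A&B\\C&D\end{bmatrix}:=D-CA^{-1}B$. **Bi-orthogonal polynomials.** Let $\mu$ be a $p\times p$ matrix of Borel measures on $\mathbb{R}$ with finite moments $m_n=\int x^n d\mu(x)\in\mathbb{R}^{p\times p}$, and $M=(m_{i+j})_{i,j\ge0}$ its semi-infinite block moment matrix. Assume $\det (m_{i+j})_{0\le i,j\le k-1}\ne0$ for all $k\geq 1$, so that there is a unique factorization $M=S_1^{-1}H S_2^{-\top}$ with $S_1,S_2$ lower unitriangular block matrices (blocks $p\times p$, diagonal blocks $I_p$) and $H=\mathrm{diag}(H_0,H_1,\dots)$ block diagonal with nonsingular $H_k\in\mathbb{R}^{p\times p}$. With $\chi(x)=[I_p,I_px,I_px^2,\dots]^\top$ (block column), put $P^{[i]}(x)=[P^{[i]}_0,P^{[i]}_1,\dots]^\top:=S_i\chi(x)$, $i=1,2$; $P^{[i]}_k$ is monic of degree $k$ and $\int P^{[1]}_n\,d\mu\,(P^{[2]}_m)^\top=\delta_{n,m}H_n$. Likewise the perturbed moment matrix $\hat M=\left(\int x^{i+j}W(x)d\mu(x)\right)_{i,j\ge0}$ is assumed to have such a factorization $\hat M=\hat S_1^{-1}\hat H\hat S_2^{-\top}$ with nonsingular $\hat H_k$, and $\hat P^{[i]}(x):=\hat S_i\chi(x)$. **Christoffel--Darboux kernel.** $K_n(x,y):=\sum_{k=0}^n (P^{[2]}_k(y))^\top H_k^{-1}P^{[1]}_k(x)$. **Adapted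 root polynomials.** Let $x_1,\dots,x_q\in\mathbb{C}$ be the distinct zeros of $\det W(x)$, with multiplicities $\alpha_1,\dots,\alpha_q$, $\sum_i\alpha_i=Np$, and $s_i=\dim\operatorname{Ker}W(x_i)$. A root polynomial of $W$ at $x_i$ is $v\in\mathbb{C}^p[x]$ with $v(x_i)\ne0$ and $W(x_i)v(x_i)=0$; its order $\kappa$ is the order of the zero of $W(x)v(x)$ at $x=x_i$. For each $i$ choose root polynomials successively for $j=1,\dots,s_i$ so that the $j$-th one has the largest order $\kappa^{(i)}_j$ among all root polynomials at $x_i$ whose value at $x_i$ is not in the span of the values at $x_i$ of the previous $j-1$ chosen ones; let $v^{(i)}_{j,r}$, $0\le r\le\kappa^{(i)}_j-1$, be its Taylor coefficients at $x_i$ (a canonical set of Jordan chains; $\sum_{j=1}^{s_i}\kappa_j^{(i)}=\alpha_i$). The adapted root polynomials are $v^{(i)}_j(x)=\sum_{r=0}^{\kappa_j^{(i)}-1}v^{(i)}_{j,r}(x-x_i)^r$. **The matrices $\pi_k,\Pi_{k,N},\gamma_n$.** Put $\pi^{(r),(i)}_{j,k}:=\frac{d^r(P^{[1]}_kv^{(i)}_j)}{dx^r}\big|_{x=x_i}\in\mathbb{C}^p$, $\pi_k^{(i)}:=[\pi^{(0),(i)}_{1,k},\dots,\pi^{(\kappa^{(i)}_1-1),(i)}_{1,k},\dots,\pi^{(0),(i)}_{s_i,k},\dots,\pi^{(\kappa^{(i)}_{s_i}-1),(i)}_{s_i,k}]\in\mathbb{C}^{p\times\alpha_i}$, $\pi_k:=[\pi_k^{(1)},\dots,\pi_k^{(q)}]\in\mathbb{C}^{p\times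 Np}$, and $\Pi_{k,N}:=\begin{bmatrix}\pi_k\\ \vdots\\ \pi_{k+N-1}\end{bmatrix}\in\mathbb{C}^{Np\times Np}$. Similarly, $\gamma^{(r),(i)}_{j,n}(y):=\frac{d^r(K_n(x,y)v^{(i)}_j(x))}{dx^r}\big|_{x=x_i}\in\mathbb{C}^p[y]$, and $\gamma_n(y)\in\mathbb{C}^{p\times Np}[y]$ is the row arrangement of these columns in the same order as in $\pi_k$. *)

theory Defs
  imports
    "HOL-Analysis.Bochner_Integration"
    "Jordan_Normal_Form.Matrix_Kernel"
    "Jordan_Normal_Form.Gauss_Jordan_Elimination"
begin



section \<open>Matrices\<close>

text \<open>Meaningful for nonsingular square matrices only.\<close>

definition minv :: "'a::field mat \<Rightarrow> 'a mat" where
  "minv A = the (mat_inverse A)"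

definition last_quasidet :: "'a::field mat \<Rightarrow> 'a mat \<Rightarrow> 'a mat \<Rightarrow> 'a mat \<Rightarrow> 'a mat" where
  "last_quasidet A B C D = D - C * minv A * B"

definition msum :: "nat \<Rightarrow> ('i \<Rightarrow> 'a::comm_monoid_add mat) \<Rightarrow> 'i set \<Rightarrow> 'a mat" where
  "msum p F I = mat p p (\<lambda>(a, b). \<Sum>i\<in>I. F i $$ (a, b))"

text \<open>The blocks \<open>X 0, \<dots>, X (N - 1)\<close>, each with \<open>p\<close> rows, stacked on top of each other.\<close>

definition block_col :: "nat \<Rightarrow> nat \<Rightarrow> (nat \<Rightarrow> 'a mat) \<Rightarrow> 'a mat" where
  "block_col p N X = mat (N * p) (dim_col (X 0)) (\<lambda>(i, j). X (i div p) $$ (i mod p, j))"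

text \<open>The leading \<open>k \<times> k\<close> block truncation of a semi-infinite block matrix with
  \<open>p \<times> p\<close> blocks.\<close>

definition block_trunc :: "nat \<Rightarrow> nat \<Rightarrow> (nat \<Rightarrow> nat \<Rightarrow> 'a mat) \<Rightarrow> 'a mat" where
  "block_trunc p k M =
     mat (k * p) (k * p) (\<lambda>(i, j). M (i div p) (j div p) $$ (i mod p, j mod p))"

definition pmat_at :: "'a::comm_semiring_0 poly mat \<Rightarrow> 'a \<Rightarrow> 'a mat" where
  "pmat_at A x = map_mat (\<lambda>f. poly f x) A"

definition pvec_at :: "'a::comm_semiring_0 poly vec \<Rightarrow> 'a \<Rightarrow> 'a vec" where
  "pvec_at v x = map_vec (\<lambda>f. poly f x) v"

definition cmat :: "real mat \<Rightarrow> complex mat" where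
  "cmat = map_mat complex_of_real"

definition cpmat :: "real poly mat \<Rightarrow> complex poly mat" where
  "cpmat = map_mat (map_poly complex_of_real)"

text \<open>\<open>A = I x\<^sup>N + \<close> terms of lower degree.\<close>

definition monic_pmat :: "nat \<Rightarrow> nat \<Rightarrow> 'a::comm_semiring_1 poly mat \<Rightarrow> bool" where
  "monic_pmat p N A \<longleftrightarrow> A \<in> carrier_mat p p \<and>
     map_mat (\<lambda>f. coeff f N) A = 1\<^sub>m p \<and>
     (\<forall>n>N. map_mat (\<lambda>f. coeff f n) A = 0\<^sub>m p p)"


section \<open>Matrices of measures and bi-orthogonal polynomials\<close>

text \<open>A pair \<open>(M\<^sub>+, M\<^sub>-)\<close> of positive Borel measures stands for the signed measure
  \<open>M\<^sub>+ - M\<^sub>-\<close>; by the Jordan decomposition every finite signed Borel measure arises in this way,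
  and a positive measure \<open>M\<close> is \<open>(M, null_measure borel)\<close>. Signed entries are needed, because
  the entries of \<open>W d\<mu>\<close> are in general signed even if those of \<open>\<mu>\<close> are positive.\<close>

type_synonym signed_measure = "real measure \<times> real measure"

type_synonym measure_matrix = "nat \<Rightarrow> nat \<Rightarrow> signed_measure"

definition signed_integral :: "signed_measure \<Rightarrow> (real \<Rightarrow> real) \<Rightarrow> real" where
  "signed_integral \<nu> f = (\<integral>x. f x \<partial>fst \<nu>) - (\<integral>x. f x \<partial>snd \<nu>)"

definition finite_moments :: "nat \<Rightarrow> measure_matrix \<Rightarrow> bool" where
  "finite_moments p \<mu> \<longleftrightarrow> (\<forall>a<p. \<forall>b<p. \<forall>M\<in>{fst (\<mu> a b), snd (\<mu> a b)}.
     sets M = sets borel \<and> (\<forall>n. integrable M (\<lambda>x. x ^ n)))"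

text \<open>\<open>\<integral> F d\<mu>\<close> for a matrix-valued function \<open>F\<close> multiplying from the left.\<close>

definition matrix_integral :: "nat \<Rightarrow> measure_matrix \<Rightarrow> (real \<Rightarrow> real mat) \<Rightarrow> real mat" where
  "matrix_integral p \<mu> F =
     mat p p (\<lambda>(a, b). \<Sum>c<p. signed_integral (\<mu> c b) (\<lambda>x. F x $$ (a, c)))"

text \<open>Semi-infinite block matrices are families of \<open>p \<times> p\<close> blocks.\<close>

definition moment_matrix :: "nat \<Rightarrow> measure_matrix \<Rightarrow> nat \<Rightarrow> nat \<Rightarrow> real mat" where
  "moment_matrix p \<mu> i j = matrix_integral p \<mu> (\<lambda>x. x ^ (i + j) \<cdot>\<^sub>m 1\<^sub>m p)"

definition perturbed_moment_matrix ::
    "nat \<Rightarrow> real poly mat \<Rightarrow> measure_matrix \<Rightarrow> nat \<Rightarrow> nat \<Rightarrow> real mat" where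
  "perturbed_moment_matrix p W \<mu> i j = matrix_integral p \<mu> (\<lambda>x. x ^ (i + j) \<cdot>\<^sub>m pmat_at W x)"

definition lower_unitriangular :: "nat \<Rightarrow> (nat \<Rightarrow> nat \<Rightarrow> real mat) \<Rightarrow> bool" where
  "lower_unitriangular p S \<longleftrightarrow> (\<forall>i j. S i j \<in> carrier_mat p p) \<and>
     (\<forall>i. S i i = 1\<^sub>m p) \<and> (\<forall>i j. i < j \<longrightarrow> S i j = 0\<^sub>m p p)"

text \<open>The block product of \<open>S\<close> and \<open>L\<close> at \<open>(i, j)\<close> reduces to the sum over \<open>k \<le> i\<close> since the first
  factor is lower triangular.\<close>

definition lower_unitriangular_inverse ::
    "nat \<Rightarrow> (nat \<Rightarrow> nat \<Rightarrow> real mat) \<Rightarrow> (nat \<Rightarrow> nat \<Rightarrow> real mat) \<Rightarrow> bool" where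
  "lower_unitriangular_inverse p S L \<longleftrightarrow> lower_unitriangular p S \<and> lower_unitriangular p L \<and>
     (\<forall>i j. msum p (\<lambda>k. S i k * L k j) {..i} = (if i = j then 1\<^sub>m p else 0\<^sub>m p p)) \<and>
     (\<forall>i j. msum p (\<lambda>k. L i k * S k j) {..i} = (if i = j then 1\<^sub>m p else 0\<^sub>m p p))"

text \<open>The factorization \<open>M = S1\<^sup>-\<^sup>1 H S2\<^sup>-\<^sup>\<top>\<close> with \<open>H = diag(H 0, H 1, \<dots>)\<close>; below,
  \<open>L1 = S1\<^sup>-\<^sup>1\<close> and \<open>L2 = S2\<^sup>-\<^sup>1\<close>.\<close>

definition gauss_borel :: "nat \<Rightarrow> (nat \<Rightarrow> nat \<Rightarrow> real mat) \<Rightarrow>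
    (nat \<Rightarrow> nat \<Rightarrow> real mat) \<Rightarrow> (nat \<Rightarrow> real mat) \<Rightarrow> (nat \<Rightarrow> nat \<Rightarrow> real mat) \<Rightarrow> bool" where
  "gauss_borel p M S1 H S2 \<longleftrightarrow>
     (\<forall>k. H k \<in> carrier_mat p p \<and> det (H k) \<noteq> 0) \<and>
     (\<exists>L1 L2. lower_unitriangular_inverse p S1 L1 \<and> lower_unitriangular_inverse p S2 L2 \<and>
       (\<forall>i j. M i j = msum p (\<lambda>k. L1 i k * H k * transpose_mat (L2 j k)) {..min i j}))"

text \<open>The \<open>k\<close>-th block of \<open>S \<chi>(x)\<close>, for lower triangular \<open>S\<close>.\<close>

definition biorth_poly :: "nat \<Rightarrow> (nat \<Rightarrow> nat \<Rightarrow> real mat) \<Rightarrow> nat \<Rightarrow> real poly mat" where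
  "biorth_poly p S k = msum p (\<lambda>j. map_mat (\<lambda>c. monom c j) (S k j)) {..k}"

text \<open>\<open>K\<^sub>n(x, y)\<close> as a matrix polynomial in \<open>x\<close>, for a given value of \<open>y\<close>.\<close>

definition CD_kernel :: "nat \<Rightarrow> (nat \<Rightarrow> nat \<Rightarrow> real mat) \<Rightarrow> (nat \<Rightarrow> real mat) \<Rightarrow>
    (nat \<Rightarrow> nat \<Rightarrow> real mat) \<Rightarrow> nat \<Rightarrow> complex \<Rightarrow> complex poly mat" where
  "CD_kernel p S1 H S2 n y = msum p (\<lambda>k.
     map_mat (\<lambda>c. [:c:])
       (transpose_mat (pmat_at (cpmat (biorth_poly p S2 k)) y) * cmat (minv (H k)))
     * cpmat (biorth_poly p S1 k)) {..n}"


section \<open>Root polynomials\<close>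

definition root_poly :: "nat \<Rightarrow> complex poly mat \<Rightarrow> complex \<Rightarrow> complex poly vec \<Rightarrow> bool" where
  "root_poly p W z v \<longleftrightarrow> v \<in> carrier_vec p \<and> pvec_at v z \<noteq> 0\<^sub>v p \<and>
     pmat_at W z *\<^sub>v pvec_at v z = 0\<^sub>v p"

text \<open>The order of the zero at \<open>z\<close> of a nonzero vector polynomial, cf. \<^const>\<open>Polynomial.order\<close>.\<close>

definition vec_order :: "complex \<Rightarrow> complex poly vec \<Rightarrow> nat" where
  "vec_order z u = (LEAST n. \<exists>a<dim_vec u. \<not> [:- z, 1:] ^ Suc n dvd u $ a)"

definition root_order :: "complex poly mat \<Rightarrow> complex \<Rightarrow> complex poly vec \<Rightarrow> nat" where
  "root_order W z v = vec_order z (W *\<^sub>v v)"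

definition vspan :: "nat \<Rightarrow> complex vec set \<Rightarrow> complex vec set" where
  "vspan p A = LinearCombinations.module.span class_ring (module_vec TYPE(complex) p) A"

text \<open>The family \<open>v 0, \<dots>, v (s - 1)\<close> with \<open>s = dim Ker W(z)\<close> is a canonical choice of root
  polynomials at \<open>z\<close>.\<close>

definition canonical_root_polys ::
    "nat \<Rightarrow> complex poly mat \<Rightarrow> complex \<Rightarrow> (nat \<Rightarrow> complex poly vec) \<Rightarrow> bool" where
  "canonical_root_polys p W z v \<longleftrightarrow> (\<forall>j<kernel_dim (pmat_at W z).
     root_poly p W z (v j) \<and>
     pvec_at (v j) z \<notin> vspan p ((\<lambda>i. pvec_at (v i) z) ` {..<j}) \<and>
     (\<forall>u. root_poly p W z u \<and> pvec_at u z \<notin> vspan p ((\<lambda>i. pvec_at (v i) z) ` {..<j}) \<longrightarrow>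
          root_order W z u \<le> root_order W z (v j)))"

text \<open>The Taylor polynomial of \<open>v\<close> at \<open>z\<close> of degree less than \<open>root_order W z v\<close>.\<close>

definition adapted_root_poly ::
    "nat \<Rightarrow> complex poly mat \<Rightarrow> complex \<Rightarrow> complex poly vec \<Rightarrow> complex poly vec" where
  "adapted_root_poly p W z v = vec p (\<lambda>a. \<Sum>r<root_order W z v.
     [:poly ((pderiv ^^ r) (v $ a)) z / fact r:] * [:- z, 1:] ^ r)"

text \<open>The columns \<open>d\<^sup>r/dx\<^sup>r (F v)\<close> at the zeros \<open>z\<close> in the list \<open>zs\<close>, where \<open>v\<close> runs through the adapted
  root polynomials at \<open>z\<close>; the index \<open>r\<close> varies fastest, the zero \<open>z\<close> slowest.\<close>

definition root_jet :: "nat \<Rightarrow> complex poly mat \<Rightarrow> complex list \<Rightarrow>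
    (complex \<Rightarrow> nat \<Rightarrow> complex poly vec) \<Rightarrow> complex poly mat \<Rightarrow> complex mat" where
  "root_jet p W zs v F = mat_of_cols p
     [pvec_at (map_vec (pderiv ^^ r) (F *\<^sub>v adapted_root_poly p W z (v z j))) z.
        z \<leftarrow> zs, j \<leftarrow> [0..<kernel_dim (pmat_at W z)], r \<leftarrow> [0..<root_order W z (v z j)]]"

definition pi_mat :: "nat \<Rightarrow> complex poly mat \<Rightarrow> complex list \<Rightarrow>
    (complex \<Rightarrow> nat \<Rightarrow> complex poly vec) \<Rightarrow> (nat \<Rightarrow> nat \<Rightarrow> real mat) \<Rightarrow> nat \<Rightarrow> complex mat" where
  "pi_mat p W zs v S1 k = root_jet p W zs v (cpmat (biorth_poly p S1 k))"

definition Pi_mat :: "nat \<Rightarrow> complex poly mat \<Rightarrow> complex list \<Rightarrow>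
    (complex \<Rightarrow> nat \<Rightarrow> complex poly vec) \<Rightarrow> (nat \<Rightarrow> nat \<Rightarrow> real mat) \<Rightarrow> nat \<Rightarrow> nat \<Rightarrow> complex mat" where
  "Pi_mat p W zs v S1 k N = block_col p N (\<lambda>l. pi_mat p W zs v S1 (k + l))"

definition gamma_mat :: "nat \<Rightarrow> complex poly mat \<Rightarrow> complex list \<Rightarrow>
    (complex \<Rightarrow> nat \<Rightarrow> complex poly vec) \<Rightarrow> (nat \<Rightarrow> nat \<Rightarrow> real mat) \<Rightarrow> (nat \<Rightarrow> real mat) \<Rightarrow>
    (nat \<Rightarrow> nat \<Rightarrow> real mat) \<Rightarrow> nat \<Rightarrow> complex \<Rightarrow> complex mat" where
  "gamma_mat p W zs v S1 H S2 n y = root_jet p W zs v (CD_kernel p S1 H S2 n y)"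

end

theory Submission
  imports Defs
begin

text \<open>Put \<open>\<omega> = S1' W(\<Lambda>) S1\<^sup>-\<^sup>1\<close>, where \<open>\<Lambda>\<close> is the shift, so that \<open>P1' W = \<omega> P1\<close>. This is
  banded, with \<open>\<omega>\<^sub>k\<^sub>,\<^sub>k\<^sub>+\<^sub>N = I\<close>, while \<open>M' = W(\<Lambda>) M\<close> turns it into \<open>\<omega> = H' (S2 S2'\<^sup>-\<^sup>1)\<^sup>\<top> H\<^sup>-\<^sup>1\<close>, which gives
  \<open>\<omega>\<^sub>k\<^sub>,\<^sub>j = 0\<close> for \<open>j < k\<close>, \<open>\<omega>\<^sub>k\<^sub>,\<^sub>k H\<^sub>k = H'\<^sub>k\<close> and \<open>P2\<^sup>\<top> H\<^sup>-\<^sup>1 = P2'\<^sup>\<top> H'\<^sup>-\<^sup>1 \<omega>\<close>. Hence both \<open>P1'\<^sub>k W - P1\<^sub>k\<^sub>+\<^sub>N\<close>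
  and \<open>K'\<^sub>n W - K\<^sub>n\<close>, where \<open>K'\<^sub>n\<close> is the perturbed kernel, are combinations of \<open>N\<close> consecutive \<open>P1\<^sub>j\<close>. The jets at the zeros of \<open>det W\<close> along the adapted root polynomials
  annihilate every left multiple of \<open>W\<close>; this determines the coefficients of the combinations as soon
  as \<open>\<Pi>\<close> is nonsingular, and the last quasideterminants only evaluate the combinations.\<close>

section \<open>Block sums\<close>

lemma msum_carrier [simp, intro]: "msum p F I \<in> carrier_mat p p"
  by (simp add: msum_def)

lemma msum_dim [simp]: "dim_row (msum p F I) = p" "dim_col (msum p F I) = p"
  by (simp_all add: msum_def)

lemma msum_index: "a < p \<Longrightarrow> b < p \<Longrightarrow> msum p F I $$ (a, b) = (\<Sum>i\<in>I. F i $$ (a, b))"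
  by (simp add: msum_def)

lemma msum_cong: "I = J \<Longrightarrow> (\<And>i. i \<in> J \<Longrightarrow> F i = G i) \<Longrightarrow> msum p F I = msum p G J"
  by (auto simp: msum_def intro!: eq_matI sum.cong)

lemma msum_swap: "msum p (\<lambda>i. msum p (F i) J) I = msum p (\<lambda>j. msum p (\<lambda>i. F i j) I) J"
  by (rule eq_matI) (auto simp: msum_index intro: sum.swap)

lemma msum_subset:
  assumes "finite J" "I \<subseteq> J" "\<And>i. i \<in> J - I \<Longrightarrow> F i = 0\<^sub>m p p"
  shows "msum p F I = msum p F J"
  using assms by (intro eq_matI) (auto simp: msum_index intro!: sum.mono_neutral_left)

lemma msum_single:
  assumes "finite I" "i \<in> I" "F i \<in> carrier_mat p p" "\<And>j. j \<in> I - {i} \<Longrightarrow> F j = 0\<^sub>m p p"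
  shows "msum p F I = F i"
proof -
  have "msum p F I = msum p F {i}"
    using assms by (intro msum_subset [symmetric]) auto
  also have "\<dots> = F i"
    using assms(3) by (intro eq_matI) (auto simp: msum_index)
  finally show ?thesis .
qed

lemma msum_zero:
  assumes "\<And>i. i \<in> I \<Longrightarrow> F i = 0\<^sub>m p p"
  shows "msum p F I = 0\<^sub>m p p"
  using assms by (intro eq_matI) (auto simp: msum_index)

lemma msum_split:
  fixes n N :: nat
  shows "msum p F {..n + N} = msum p F {..n} + msum p (\<lambda>l. F (n + 1 + l)) {..<N}"
proof (rule eq_matI)
  fix a b assume "a < dim_row (msum p F {..n} + msum p (\<lambda>l. F (n + 1 + l)) {..<N})"
    "b < dim_col (msum p F {..n} + msum p (\<lambda>l. F (n + 1 + l)) {..<N})"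
  then have ab: "a < p" "b < p" by auto
  have "(\<Sum>i\<le>n + N. F i $$ (a, b)) = (\<Sum>i\<le>n. F i $$ (a, b)) + (\<Sum>l<N. F (n + 1 + l) $$ (a, b))"
    by (induction N) (simp_all add: add.assoc)
  with ab show "msum p F {..n + N} $$ (a, b) =
      (msum p F {..n} + msum p (\<lambda>l. F (n + 1 + l)) {..<N}) $$ (a, b)"
    by (simp add: msum_index)
qed auto

text \<open>Trims a sum to the band from \<open>k\<close> to \<open>k + N\<close> and separates its
  top term, where the connection matrix has the block \<open>1\<^sub>m p\<close>.\<close>

lemma msum_shift:
  fixes k N :: nat
  assumes "\<And>j. j < k \<Longrightarrow> F j = 0\<^sub>m p p" "F (k + N) \<in> carrier_mat p p"
  shows "msum p F {..k + N} = F (k + N) + msum p (\<lambda>l. F (k + l)) {..<N}"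
proof (rule eq_matI)
  fix a b assume "a < dim_row (F (k + N) + msum p (\<lambda>l. F (k + l)) {..<N})"
    "b < dim_col (F (k + N) + msum p (\<lambda>l. F (k + l)) {..<N})"
  then have ab: "a < p" "b < p" by auto
  have "(\<Sum>i\<le>k + N. F i $$ (a, b)) = (\<Sum>l<Suc N. F (k + l) $$ (a, b))"
  proof (induction N)
    case 0
    show ?case
      using assms(1) ab by (simp add: lessThan_Suc_atMost [symmetric])
  qed simp
  with ab assms(2) show "msum p F {..k + N} $$ (a, b) =
      (F (k + N) + msum p (\<lambda>l. F (k + l)) {..<N}) $$ (a, b)"
    by (simp add: msum_index add.commute)
qed (use assms in auto)

lemma smult_smult_mat: "c \<cdot>\<^sub>m (d \<cdot>\<^sub>m A) = (c * d :: 'a::semigroup_mult) \<cdot>\<^sub>m A"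
  by (rule eq_matI) (simp_all add: mult.assoc)

lemma msum_mult:
  fixes F :: "'i \<Rightarrow> 'a::semiring_0 mat"
  assumes "\<And>i. i \<in> I \<Longrightarrow> F i \<in> carrier_mat p p" "B \<in> carrier_mat p p"
  shows "msum p F I * B = msum p (\<lambda>i. F i * B) I"
proof (rule eq_matI)
  fix a b assume "a < dim_row (msum p (\<lambda>i. F i * B) I)" "b < dim_col (msum p (\<lambda>i. F i * B) I)"
  then have ab: "a < p" "b < p" by auto
  have "(msum p F I * B) $$ (a, b) = (\<Sum>c = 0..<p. (\<Sum>i\<in>I. F i $$ (a, c)) * B $$ (c, b))"
    using ab assms by (simp add: scalar_prod_def msum_index)
  also have "\<dots> = (\<Sum>i\<in>I. \<Sum>c = 0..<p. F i $$ (a, c) * B $$ (c, b))"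
    by (simp add: sum_distrib_right) (rule sum.swap)
  also have "\<dots> = (\<Sum>i\<in>I. (F i * B) $$ (a, b))"
  proof (rule sum.cong [OF refl])
    fix i assume "i \<in> I"
    then have "F i \<in> carrier_mat p p" by (rule assms)
    then show "(\<Sum>c = 0..<p. F i $$ (a, c) * B $$ (c, b)) = (F i * B) $$ (a, b)"
      using ab assms(2) by (auto simp: scalar_prod_def)
  qed
  finally show "(msum p F I * B) $$ (a, b) = msum p (\<lambda>i. F i * B) I $$ (a, b)"
    using ab by (simp add: msum_index)
qed (use assms in auto)

lemma mult_msum:
  fixes F :: "'i \<Rightarrow> 'a::semiring_0 mat"
  assumes "\<And>i. i \<in> I \<Longrightarrow> F i \<in> carrier_mat p p" "B \<in> carrier_mat p p"
  shows "B * msum p F I = msum p (\<lambda>i. B * F i) I"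
proof (rule eq_matI)
  fix a b assume "a < dim_row (msum p (\<lambda>i. B * F i) I)" "b < dim_col (msum p (\<lambda>i. B * F i) I)"
  then have ab: "a < p" "b < p" by auto
  have "(B * msum p F I) $$ (a, b) = (\<Sum>c = 0..<p. B $$ (a, c) * (\<Sum>i\<in>I. F i $$ (c, b)))"
    using ab assms by (simp add: scalar_prod_def msum_index)
  also have "\<dots> = (\<Sum>i\<in>I. \<Sum>c = 0..<p. B $$ (a, c) * F i $$ (c, b))"
    by (simp add: sum_distrib_left) (rule sum.swap)
  also have "\<dots> = (\<Sum>i\<in>I. (B * F i) $$ (a, b))"
  proof (rule sum.cong [OF refl])
    fix i assume "i \<in> I"
    then have "F i \<in> carrier_mat p p" by (rule assms)
    then show "(\<Sum>c = 0..<p. B $$ (a, c) * F i $$ (c, b)) = (B * F i) $$ (a, b)"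
      using ab assms(2) by (auto simp: scalar_prod_def)
  qed
  finally show "(B * msum p F I) $$ (a, b) = msum p (\<lambda>i. B * F i) I $$ (a, b)"
    using ab by (simp add: msum_index)
qed (use assms in auto)

lemma smult_msum:
  fixes F :: "'i \<Rightarrow> 'a::semiring_0 mat"
  assumes "\<And>i. i \<in> I \<Longrightarrow> F i \<in> carrier_mat p p"
  shows "c \<cdot>\<^sub>m msum p F I = msum p (\<lambda>i. c \<cdot>\<^sub>m F i) I"
proof (rule eq_matI)
  fix a b assume "a < dim_row (msum p (\<lambda>i. c \<cdot>\<^sub>m F i) I)" "b < dim_col (msum p (\<lambda>i. c \<cdot>\<^sub>m F i) I)"
  then have "a < p" "b < p" by auto
  moreover from this assms have "(\<Sum>i\<in>I. (c \<cdot>\<^sub>m F i) $$ (a, b)) = (\<Sum>i\<in>I. c * F i $$ (a, b))"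
    by (intro sum.cong) (auto simp: carrier_matD [OF assms(1)])
  ultimately show "(c \<cdot>\<^sub>m msum p F I) $$ (a, b) = msum p (\<lambda>i. c \<cdot>\<^sub>m F i) I $$ (a, b)"
    by (simp add: msum_index sum_distrib_left)
qed auto

lemma transpose_msum:
  assumes "\<And>i. i \<in> I \<Longrightarrow> F i \<in> carrier_mat p p"
  shows "transpose_mat (msum p F I) = msum p (\<lambda>i. transpose_mat (F i)) I"
proof (rule eq_matI)
  fix a b assume "a < dim_row (msum p (\<lambda>i. transpose_mat (F i)) I)" "b < dim_col (msum p (\<lambda>i. transpose_mat (F i)) I)"
  then have "a < p" "b < p" by auto
  moreover from this assms have "(\<Sum>i\<in>I. transpose_mat (F i) $$ (a, b)) = (\<Sum>i\<in>I. F i $$ (b, a))"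
    by (intro sum.cong) (auto simp: carrier_matD [OF assms(1)])
  ultimately show "transpose_mat (msum p F I) $$ (a, b) = msum p (\<lambda>i. transpose_mat (F i)) I $$ (a, b)"
    by (simp add: msum_index)
qed auto

lemma map_mat_msum:
  assumes "\<And>i. i \<in> I \<Longrightarrow> F i \<in> carrier_mat p p" "h 0 = 0" "\<And>x y. h (x + y) = h x + h y"
  shows "map_mat h (msum p F I) = msum p (\<lambda>i. map_mat h (F i)) I"
proof (rule eq_matI)
  fix a b assume "a < dim_row (msum p (\<lambda>i. map_mat h (F i)) I)" "b < dim_col (msum p (\<lambda>i. map_mat h (F i)) I)"
  then have ab: "a < p" "b < p" by auto
  then have "(\<Sum>i\<in>I. map_mat h (F i) $$ (a, b)) = (\<Sum>i\<in>I. h (F i $$ (a, b)))"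
    using assms(1) by (intro sum.cong) (auto simp: carrier_matD [OF assms(1)])
  also have "\<dots> = h (\<Sum>i\<in>I. F i $$ (a, b))"
    by (induction I rule: infinite_finite_induct) (simp_all add: assms)
  finally show "map_mat h (msum p F I) $$ (a, b) = msum p (\<lambda>i. map_mat h (F i)) I $$ (a, b)"
    using ab by (simp add: msum_index)
qed auto

section \<open>Connection formulas\<close>

text \<open>Counterpart of \<open>lower_unitriangular_inverse\<close> over any commutative ring: the
  factorization is given over the reals, but the zeros of det W are complex.\<close>

definition tri_inverse ::
    "nat \<Rightarrow> (nat \<Rightarrow> nat \<Rightarrow> 'a::comm_ring_1 mat) \<Rightarrow> (nat \<Rightarrow> nat \<Rightarrow> 'a mat) \<Rightarrow> bool" where
  "tri_inverse p S L \<longleftrightarrow> (\<forall>i j. S i j \<in> carrier_mat p p) \<and> (\<forall>i j. L i j \<in> carrier_mat p p) \<and>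
     (\<forall>i. S i i = 1\<^sub>m p) \<and> (\<forall>i. L i i = 1\<^sub>m p) \<and>
     (\<forall>i j. i < j \<longrightarrow> S i j = 0\<^sub>m p p) \<and> (\<forall>i j. i < j \<longrightarrow> L i j = 0\<^sub>m p p) \<and>
     (\<forall>i j. msum p (\<lambda>k. S i k * L k j) {..i} = (if i = j then 1\<^sub>m p else 0\<^sub>m p p)) \<and>
     (\<forall>i j. msum p (\<lambda>k. L i k * S k j) {..i} = (if i = j then 1\<^sub>m p else 0\<^sub>m p p))"

text \<open>The value at \<open>x\<close> of block \<open>k\<close> of S \<chi>. Working with values
  keeps the algebra inside matrices over a field; polynomial identities are recovered later from
  equality at all points.\<close>

definition tri_poly :: "nat \<Rightarrow> (nat \<Rightarrow> nat \<Rightarrow> 'a::comm_ring_1 mat) \<Rightarrow> nat \<Rightarrow> 'a \<Rightarrow> 'a mat" where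
  "tri_poly p S k x = msum p (\<lambda>j. x ^ j \<cdot>\<^sub>m S k j) {..k}"

lemma tri_inverse_sym: "tri_inverse p S L \<Longrightarrow> tri_inverse p L S"
  by (simp add: tri_inverse_def)

lemma
  assumes "tri_inverse p S L"
  shows tri_inverse_carrier: "S i j \<in> carrier_mat p p"
    and tri_inverse_diag: "S i i = 1\<^sub>m p"
    and tri_inverse_upper: "i < j \<Longrightarrow> S i j = 0\<^sub>m p p"
  using assms by (simp_all add: tri_inverse_def)

text \<open>Triangularity of \<open>S\<close> makes the terms beyond \<open>i\<close> vanish. A
  bound common to several rows is what permits exchanging the order of summation.\<close>

lemma tri_inverse_mult:
  assumes "tri_inverse p S L" "i \<le> n"
  shows "msum p (\<lambda>k. S i k * L k j) {..n} = (if i = j then 1\<^sub>m p else 0\<^sub>m p p)"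
proof -
  note c = tri_inverse_carrier [OF tri_inverse_sym, OF assms(1)]
  have "msum p (\<lambda>k. S i k * L k j) {..n} = msum p (\<lambda>k. S i k * L k j) {..i}"
    using assms(2) by (intro msum_subset [symmetric])
      (auto simp: tri_inverse_upper [OF assms(1)] left_mult_zero_mat [OF c])
  then show ?thesis using assms(1) unfolding tri_inverse_def by simp
qed

lemma tri_poly_carrier [simp, intro]: "tri_poly p S k x \<in> carrier_mat p p"
  by (simp add: tri_poly_def)

lemma tri_poly_extend:
  assumes "tri_inverse p S L" "k \<le> n"
  shows "tri_poly p S k x = msum p (\<lambda>j. x ^ j \<cdot>\<^sub>m S k j) {..n}"
  unfolding tri_poly_def using assms
  by (intro msum_subset) (auto simp: tri_inverse_upper [OF assms(1)])

text \<open>Row \<open>i\<close> of L S \<chi> = \<chi>: the monomials expressed in the monic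
  polynomials.\<close>

lemma tri_poly_expand:
  assumes SL: "tri_inverse p S L" and n: "i \<le> n"
  shows "msum p (\<lambda>j. L i j * tri_poly p S j x) {..n} = x ^ i \<cdot>\<^sub>m 1\<^sub>m p"
proof -
  note [simp] = tri_inverse_carrier [OF SL] tri_inverse_carrier [OF tri_inverse_sym, OF SL]
    mult_carrier_mat [of _ p p]
  have "msum p (\<lambda>j. L i j * tri_poly p S j x) {..n} =
      msum p (\<lambda>j. msum p (\<lambda>m. x ^ m \<cdot>\<^sub>m (L i j * S j m)) {..n}) {..n}"
    by (intro msum_cong)
      (auto simp: tri_poly_extend [OF SL] mult_msum mult_smult_distrib [of _ p p _ p])
  also have "\<dots> = msum p (\<lambda>m. msum p (\<lambda>j. x ^ m \<cdot>\<^sub>m (L i j * S j m)) {..n}) {..n}"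
    by (rule msum_swap)
  also have "\<dots> = msum p (\<lambda>m. x ^ m \<cdot>\<^sub>m (if i = m then 1\<^sub>m p else 0\<^sub>m p p)) {..n}"
    by (intro msum_cong)
      (simp_all add: smult_msum [symmetric] tri_inverse_mult [OF tri_inverse_sym, OF SL n])
  also have "\<dots> = x ^ i \<cdot>\<^sub>m (if i = i then 1\<^sub>m p else 0\<^sub>m p p)"
    using n by (intro msum_single) auto
  finally show ?thesis by simp
qed

text \<open>The purely algebraic situation. \<open>K\<close> and \<open>K'\<close> are the inverses
  of the norms, \<open>A l\<close> are the coefficients of W, and \<open>shift\<close> is the
  equation M' = W(\<Lambda>) M block by block; the measure enters only through it.\<close>

locale christoffel =
  fixes p N :: nat
    and S1 L1 S2 L2 S1' L1' S2' L2' M M' :: "nat \<Rightarrow> nat \<Rightarrow> 'a::field mat"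
    and H H' K K' A :: "nat \<Rightarrow> 'a mat"
  assumes SL1: "tri_inverse p S1 L1" and SL2: "tri_inverse p S2 L2"
    and SL1': "tri_inverse p S1' L1'" and SL2': "tri_inverse p S2' L2'"
    and H: "\<And>k. H k \<in> carrier_mat p p" and H': "\<And>k. H' k \<in> carrier_mat p p"
    and K: "\<And>k. K k \<in> carrier_mat p p" "\<And>k. H k * K k = 1\<^sub>m p"
    and K': "\<And>k. K' k \<in> carrier_mat p p" "\<And>k. K' k * H' k = 1\<^sub>m p"
    and A: "\<And>l. A l \<in> carrier_mat p p" and A_lead: "A N = 1\<^sub>m p"
    and M: "\<And>i j. M i j = msum p (\<lambda>k. L1 i k * H k * transpose_mat (L2 j k)) {..min i j}"
    and M': "\<And>i j. M' i j = msum p (\<lambda>k. L1' i k * H' k * transpose_mat (L2' j k)) {..min i j}"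
    and shift: "\<And>i j. M' i j = msum p (\<lambda>l. A l * M (i + l) j) {..N}"
begin

lemmas carriers [simp] =
  SL1 [THEN tri_inverse_carrier] SL1 [THEN tri_inverse_sym, THEN tri_inverse_carrier]
  SL2 [THEN tri_inverse_carrier] SL2 [THEN tri_inverse_sym, THEN tri_inverse_carrier]
  SL1' [THEN tri_inverse_carrier] SL1' [THEN tri_inverse_sym, THEN tri_inverse_carrier]
  SL2' [THEN tri_inverse_carrier] SL2' [THEN tri_inverse_sym, THEN tri_inverse_carrier]
  H H' K(1) K'(1) A mult_carrier_mat [of _ p p _ p]

lemmas uppers =
  SL1 [THEN tri_inverse_upper] SL1 [THEN tri_inverse_sym, THEN tri_inverse_upper]
  SL2 [THEN tri_inverse_upper] SL2 [THEN tri_inverse_sym, THEN tri_inverse_upper]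
  SL1' [THEN tri_inverse_upper] SL1' [THEN tri_inverse_sym, THEN tri_inverse_upper]
  SL2' [THEN tri_inverse_upper] SL2' [THEN tri_inverse_sym, THEN tri_inverse_upper]

lemmas assoc = assoc_mult_mat [of _ p p _ p _ p]
lemmas zeros = left_mult_zero_mat [of _ p p] right_mult_zero_mat [of _ p p]
lemmas ones = left_mult_one_mat [of _ p p] right_mult_one_mat [of _ p p]
lemmas dists = mult_msum msum_mult

text \<open>Block row \<open>i\<close> of W(\<Lambda>) has \<open>A l\<close> in block column
  \<open>i + l\<close>, whence the index of \<open>L1\<close>; triangularity of \<open>S1'\<close>
  stops the outer sum at \<open>k\<close>.\<close>

definition \<omega> :: "nat \<Rightarrow> nat \<Rightarrow> 'a mat" where
  "\<omega> k j = msum p (\<lambda>i. msum p (\<lambda>l. S1' k i * A l * L1 (i + l) j) {..N}) {..k}"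

text \<open>The unitriangular matrix S2 times the inverse of S2', through which the factorization of
  M' describes \<omega> from the other side.\<close>

definition T :: "nat \<Rightarrow> nat \<Rightarrow> 'a mat" where
  "T n k = msum p (\<lambda>m. S2 n m * L2' m k) {..n}"

definition W :: "'a \<Rightarrow> 'a mat" where
  "W x = msum p (\<lambda>l. x ^ l \<cdot>\<^sub>m A l) {..N}"

lemma more_carriers [simp]:
  "\<omega> k j \<in> carrier_mat p p" "T n k \<in> carrier_mat p p" "W x \<in> carrier_mat p p"
  by (simp_all add: \<omega>_def T_def W_def)

section \<open>Band structure of the connection matrix\<close>

lemma omega_lead: "\<omega> k (k + N) = 1\<^sub>m p"
proof -
  \<comment> \<open>For \<open>i < k\<close> the row \<open>i + l\<close> of \<open>L1\<close> lies
    strictly above the diagonal position \<open>k + N\<close>; the next step excludes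
    \<open>l < N\<close> in the same way.\<close>
  have "\<omega> k (k + N) = msum p (\<lambda>l. S1' k k * A l * L1 (k + l) (k + N)) {..N}"
    unfolding \<omega>_def
    by (rule msum_single) (auto intro!: msum_zero simp: uppers zeros)
  also have "\<dots> = S1' k k * A N * L1 (k + N) (k + N)"
    by (rule msum_single) (auto simp: uppers zeros)
  finally show ?thesis
    using tri_inverse_diag [OF SL1'] tri_inverse_diag [OF tri_inverse_sym, OF SL1]
    by (simp add: A_lead)
qed

lemma omega_above: "k + N < j \<Longrightarrow> \<omega> k j = 0\<^sub>m p p"
  unfolding \<omega>_def by (auto intro!: msum_zero simp: uppers zeros)

text \<open>A term beyond \<open>min i m\<close> meets a zero block of \<open>L1\<close> or of
  \<open>L2\<close>. The resulting bound does not depend on the row \<open>i\<close>, so sums over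
  rows can be exchanged with it.\<close>

lemma M_extend:
  assumes "m \<le> n"
  shows "M i m = msum p (\<lambda>k. L1 i k * H k * transpose_mat (L2 m k)) {..n}"
  unfolding M
proof (rule msum_subset)
  fix k assume "k \<in> {..n} - {..min i m}"
  then have "L1 i k = 0\<^sub>m p p \<or> L2 m k = 0\<^sub>m p p"
    by (auto simp: uppers)
  then show "L1 i k * H k * transpose_mat (L2 m k) = 0\<^sub>m p p"
    by (auto simp: zeros)
qed (use assms in auto)

lemma M'_extend:
  assumes "m \<le> n"
  shows "M' i m = msum p (\<lambda>k. L1' i k * H' k * transpose_mat (L2' m k)) {..n}"
  unfolding M'
proof (rule msum_subset)
  fix k assume "k \<in> {..n} - {..min i m}"
  then have "L1' i k = 0\<^sub>m p p \<or> L2' m k = 0\<^sub>m p p"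
    by (auto simp: uppers)
  then show "L1' i k * H' k * transpose_mat (L2' m k) = 0\<^sub>m p p"
    by (auto simp: zeros)
qed (use assms in auto)

lemma M_carrier [simp]: "M i j \<in> carrier_mat p p" "M' i j \<in> carrier_mat p p"
  by (simp_all add: M M')

text \<open>P1' W = \<omega> P1: the product is a combination of monomials, each of which is
  expanded in the polynomials P1.\<close>

lemma P1'_W:
  assumes "k + N \<le> n"
  shows "tri_poly p S1' k x * W x = msum p (\<lambda>j. \<omega> k j * tri_poly p S1 j x) {..n}"
proof -
  have "tri_poly p S1' k x * W x =
      msum p (\<lambda>i. msum p (\<lambda>l. S1' k i * A l * (x ^ (i + l) \<cdot>\<^sub>m 1\<^sub>m p)) {..N}) {..k}"
    unfolding tri_poly_def W_def
    by (subst msum_mult) (auto simp: mult_msum smult_msum mult_smult_distrib [of _ p p _ p] mult_smult_assoc_mat [of _ p p _ p]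
        smult_smult_mat power_add mult.commute ones)
  \<comment> \<open>The expansion of the monomial of degree \<open>i + l\<close> is complete because
    \<open>i + l\<close> is at most \<open>k + N\<close>, hence at most \<open>n\<close>.\<close>
  also have "\<dots> = msum p (\<lambda>i. msum p (\<lambda>l. S1' k i * A l *
      msum p (\<lambda>j. L1 (i + l) j * tri_poly p S1 j x) {..n}) {..N}) {..k}"
    using assms by (intro msum_cong) (auto simp: tri_poly_expand [OF SL1])
  also have "\<dots> = msum p (\<lambda>i. msum p (\<lambda>l. msum p (\<lambda>j. S1' k i * A l *
      L1 (i + l) j * tri_poly p S1 j x) {..n}) {..N}) {..k}"
    by (simp add: dists assoc)
  also have "\<dots> = msum p (\<lambda>j. msum p (\<lambda>i. msum p (\<lambda>l. S1' k i * A l *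
      L1 (i + l) j * tri_poly p S1 j x) {..N}) {..k}) {..n}"
    by (subst msum_swap [of _ _ "{..n}"]) (rule msum_swap)
  also have "\<dots> = msum p (\<lambda>j. \<omega> k j * tri_poly p S1 j x) {..n}"
    by (simp add: dists \<omega>_def)
  finally show ?thesis .
qed

text \<open>Both sides are block (k, m) of S1' M'. On the left M' is written as W(\<Lambda>) M with
  M factorized, on the right M' is replaced by its own factorization.\<close>

lemma omega_H_L2:
  assumes "m \<le> n"
  shows "msum p (\<lambda>j. \<omega> k j * H j * transpose_mat (L2 m j)) {..n} = H' k * transpose_mat (L2' m k)"
proof -
  have "msum p (\<lambda>j. \<omega> k j * H j * transpose_mat (L2 m j)) {..n} =
     msum p (\<lambda>j. msum p (\<lambda>i. msum p (\<lambda>l. S1' k i * A l *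
       (L1 (i + l) j * H j * transpose_mat (L2 m j))) {..N}) {..k}) {..n}"
    by (simp add: dists \<omega>_def assoc)
  also have "\<dots> = msum p (\<lambda>i. msum p (\<lambda>l. msum p (\<lambda>j. S1' k i * A l *
       (L1 (i + l) j * H j * transpose_mat (L2 m j))) {..n}) {..N}) {..k}"
    by (subst msum_swap) (subst msum_swap [of _ _ "{..N}"], rule refl)
  \<comment> \<open>The innermost sums are the factorization of \<open>M\<close>, and
    \<open>shift\<close> then collects the sum over \<open>l\<close> into \<open>M'\<close>.\<close>
  also have "\<dots> = msum p (\<lambda>i. S1' k i * M' i m) {..k}"
    by (simp add: shift M_extend [OF assms] dists assoc)
  \<comment> \<open>The bound \<open>m + k\<close> is at least \<open>m\<close>, as
    \<open>M'_extend\<close> requires, and at least \<open>k\<close>, so that the index at which the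
    Kronecker delta survives is included.\<close>
  also have "\<dots> = msum p (\<lambda>i. S1' k i * msum p (\<lambda>j. L1' i j * H' j * transpose_mat (L2' m j)) {..m + k}) {..k}"
    by (simp add: M'_extend [of m "m + k"])
  also have "\<dots> = msum p (\<lambda>i. msum p (\<lambda>j. S1' k i * L1' i j * H' j * transpose_mat (L2' m j)) {..m + k}) {..k}"
    by (simp add: dists assoc)
  also have "\<dots> = msum p (\<lambda>j. msum p (\<lambda>i. S1' k i * L1' i j * H' j * transpose_mat (L2' m j)) {..k}) {..m + k}"
    by (rule msum_swap)
  also have "\<dots> = msum p (\<lambda>j. msum p (\<lambda>i. S1' k i * L1' i j) {..k} * (H' j * transpose_mat (L2' m j))) {..m + k}"
    by (simp add: dists assoc)
  also have "\<dots> = msum p (\<lambda>j. (if k = j then 1\<^sub>m p else 0\<^sub>m p p) * (H' j * transpose_mat (L2' m j))) {..m + k}"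
    by (simp add: tri_inverse_mult [OF SL1'])
  also have "\<dots> = (if k = k then 1\<^sub>m p else 0\<^sub>m p p) * (H' k * transpose_mat (L2' m k))"
    by (rule msum_single) (auto simp: zeros)
  finally show ?thesis by (simp add: ones)
qed

text \<open>Multiplying \<omega> H L2\<top> = H' L2'\<top>, the content of
  \<open>omega_H_L2\<close>, by S2\<top> from the right cancels L2\<top> and produces the transpose
  of \<open>T\<close>.\<close>

lemma omega_H: "\<omega> k n * H n = H' k * transpose_mat (T n k)"
proof -
  have "H' k * transpose_mat (T n k) =
      msum p (\<lambda>m. H' k * transpose_mat (L2' m k) * transpose_mat (S2 n m)) {..n}"
    by (simp add: T_def transpose_msum transpose_mult [of _ p p _ p] dists assoc)
  also have "\<dots> = msum p (\<lambda>m. msum p (\<lambda>j. \<omega> k j * H j * transpose_mat (L2 m j)) {..n} *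
      transpose_mat (S2 n m)) {..n}"
    by (intro msum_cong) (auto simp: omega_H_L2)
  also have "\<dots> = msum p (\<lambda>m. msum p (\<lambda>j. \<omega> k j * H j *
      (transpose_mat (S2 n m * L2 m j))) {..n}) {..n}"
    by (simp add: dists assoc transpose_mult [of _ p p _ p])
  also have "\<dots> = msum p (\<lambda>j. msum p (\<lambda>m. \<omega> k j * H j *
      (transpose_mat (S2 n m * L2 m j))) {..n}) {..n}"
    by (rule msum_swap)
  also have "\<dots> = msum p (\<lambda>j. \<omega> k j * H j *
      transpose_mat (msum p (\<lambda>m. S2 n m * L2 m j) {..n})) {..n}"
    by (simp add: dists transpose_msum)
  also have "\<dots> = msum p (\<lambda>j. \<omega> k j * H j *
      transpose_mat (if n = j then 1\<^sub>m p else 0\<^sub>m p p)) {..n}"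
    by (simp add: tri_inverse_mult [OF SL2])
  also have "\<dots> = \<omega> k n * H n * transpose_mat (if n = n then 1\<^sub>m p else 0\<^sub>m p p)"
    by (rule msum_single) (auto simp: zeros)
  finally show ?thesis by (simp add: ones)
qed

lemma T_zero: "n < k \<Longrightarrow> T n k = 0\<^sub>m p p"
  unfolding T_def by (auto intro!: msum_zero simp: uppers zeros)

lemma T_diag: "T k k = 1\<^sub>m p"
proof -
  have "T k k = S2 k k * L2' k k"
    unfolding T_def by (rule msum_single) (auto simp: uppers zeros)
  then show ?thesis
    using tri_inverse_diag [OF SL2] tri_inverse_diag [OF tri_inverse_sym, OF SL2'] by simp
qed

lemma omega_diag_H: "\<omega> k k * H k = H' k"
  by (simp add: omega_H T_diag ones)

text \<open>The lower edge of the band: \<omega> H = H' T\<top> is block upper triangular, and the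
  nonsingular \<open>H j\<close> can be cancelled.\<close>

lemma omega_below:
  assumes "j < k"
  shows "\<omega> k j = 0\<^sub>m p p"
proof -
  have "\<omega> k j = \<omega> k j * H j * K j"
    by (simp add: assoc K ones)
  also have "\<dots> = 0\<^sub>m p p"
    using assms by (simp add: omega_H T_zero zeros)
  finally show ?thesis .
qed

lemma P1'_W_band:
  "tri_poly p S1' k x * W x = tri_poly p S1 (k + N) x +
    msum p (\<lambda>l. \<omega> k (k + l) * tri_poly p S1 (k + l) x) {..<N}"
  unfolding P1'_W [OF order_refl]
  by (subst msum_shift) (simp_all add: omega_below zeros omega_lead ones)

section \<open>Relation between the perturbed and the unperturbed kernel\<close>

lemma T_P2': "msum p (\<lambda>i. T n i * tri_poly p S2' i x) {..n} = tri_poly p S2 n x"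
proof -
  have "msum p (\<lambda>i. T n i * tri_poly p S2' i x) {..n} =
     msum p (\<lambda>i. msum p (\<lambda>m. S2 n m * (L2' m i * tri_poly p S2' i x)) {..n}) {..n}"
    by (simp add: T_def dists assoc)
  also have "\<dots> = msum p (\<lambda>m. msum p (\<lambda>i. S2 n m * (L2' m i * tri_poly p S2' i x)) {..n}) {..n}"
    by (rule msum_swap)
  also have "\<dots> = msum p (\<lambda>m. S2 n m * msum p (\<lambda>i. L2' m i * tri_poly p S2' i x) {..n}) {..n}"
    by (simp add: dists)
  also have "\<dots> = msum p (\<lambda>m. S2 n m * (x ^ m \<cdot>\<^sub>m 1\<^sub>m p)) {..n}"
    by (intro msum_cong) (auto simp: tri_poly_expand [OF SL2'])
  also have "\<dots> = tri_poly p S2 n x"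
    unfolding tri_poly_def by (intro msum_cong) (auto simp: mult_smult_distrib [of _ p p _ p] ones)
  finally show ?thesis .
qed

text \<open>Column \<open>n\<close> of P2'\<top> K' \<omega> = P2\<top> K. Any bound
  \<open>m\<close> from \<open>n\<close> on gives the complete column, since \<omega> vanishes below
  its diagonal.\<close>

lemma P2_H_inv:
  assumes "n \<le> m"
  shows "msum p (\<lambda>i. transpose_mat (tri_poly p S2' i y) * K' i * \<omega> i n) {..m} =
    transpose_mat (tri_poly p S2 n y) * K n"
proof -
  \<comment> \<open>This is \<open>omega_H\<close> multiplied by \<open>K' i\<close> from the left
    and by \<open>K n\<close> from the right.\<close>
  have *: "K' i * \<omega> i n = transpose_mat (T n i) * K n" for i
  proof -
    have "K' i * \<omega> i n = K' i * (\<omega> i n * (H n * K n))"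
      by (simp add: K K' ones)
    also have "\<dots> = K' i * (\<omega> i n * H n) * K n"
      by (simp add: K K' assoc)
    also have "\<dots> = (K' i * H' i) * transpose_mat (T n i) * K n"
      unfolding omega_H by (simp add: K(1) K'(1) assoc)
    finally show ?thesis by (simp add: K' ones)
  qed
  have "msum p (\<lambda>i. transpose_mat (tri_poly p S2' i y) * K' i * \<omega> i n) {..m} =
    msum p (\<lambda>i. transpose_mat (tri_poly p S2' i y) * (transpose_mat (T n i) * K n)) {..m}"
    by (simp add: K' assoc *)
  also have "\<dots> = msum p (\<lambda>i. transpose_mat (tri_poly p S2' i y) * (transpose_mat (T n i) * K n)) {..n}"
    using assms by (intro msum_subset [symmetric]) (auto simp: T_zero zeros)
  also have "\<dots> = transpose_mat (msum p (\<lambda>i. T n i * tri_poly p S2' i y) {..n}) * K n"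
    by (simp add: transpose_msum transpose_mult [of _ p p _ p] dists K assoc)
  finally show ?thesis by (simp add: T_P2')
qed

text \<open>Expand each P1' W in the polynomials P1 and sort by columns of \<omega>. In columns up
  to \<open>n\<close> the sum over \<open>i\<close> is complete and gives the unperturbed kernel;
  the \<open>N\<close> columns after that are truncated and leave the coefficients
  \<open>C\<close>.\<close>

lemma kernel_identity:
  fixes n y
  defines "C \<equiv> \<lambda>l. msum p (\<lambda>i. transpose_mat (tri_poly p S2' i y) * K' i * \<omega> i (n + 1 + l)) {..n}"
  assumes N: "N \<ge> 1"
  shows "msum p (\<lambda>i. transpose_mat (tri_poly p S2' i y) * K' i * tri_poly p S1' i x) {..n} * W x =
      msum p (\<lambda>j. transpose_mat (tri_poly p S2 j y) * K j * tri_poly p S1 j x) {..n} +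
      msum p (\<lambda>l. C l * tri_poly p S1 (n + 1 + l) x) {..<N}" (is ?identity)
    and "C (N - 1) = transpose_mat (tri_poly p S2' n y) * K' n" (is ?last)
proof -
  let ?Q = "\<lambda>i. transpose_mat (tri_poly p S2' i y) * K' i"
  let ?F = "\<lambda>j. msum p (\<lambda>i. ?Q i * \<omega> i j) {..n} * tri_poly p S1 j x"
  have "msum p (\<lambda>i. ?Q i * tri_poly p S1' i x) {..n} * W x =
      msum p (\<lambda>i. ?Q i * (tri_poly p S1' i x * W x)) {..n}"
    by (simp add: dists assoc)
  also have "\<dots> = msum p (\<lambda>i. ?Q i * msum p (\<lambda>j. \<omega> i j * tri_poly p S1 j x) {..n + N}) {..n}"
    by (intro msum_cong) (auto simp: P1'_W [of _ "n + N"])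
  also have "\<dots> = msum p (\<lambda>i. msum p (\<lambda>j. ?Q i * \<omega> i j * tri_poly p S1 j x) {..n + N}) {..n}"
    by (simp add: dists assoc)
  also have "\<dots> = msum p (\<lambda>j. msum p (\<lambda>i. ?Q i * \<omega> i j * tri_poly p S1 j x) {..n}) {..n + N}"
    by (rule msum_swap)
  also have "\<dots> = msum p ?F {..n + N}"
    by (simp add: dists)
  also have "\<dots> = msum p ?F {..n} + msum p (\<lambda>l. ?F (n + 1 + l)) {..<N}"
    by (rule msum_split)
  also have "msum p ?F {..n} = msum p (\<lambda>j. transpose_mat (tri_poly p S2 j y) * K j * tri_poly p S1 j x) {..n}"
    by (intro msum_cong) (auto simp: P2_H_inv)
  finally show ?identity unfolding C_def .
  \<comment> \<open>Since \<open>N\<close> is positive, \<open>n + 1 + (N - 1)\<close> is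
    \<open>n + N\<close>. Of the rows up to \<open>n\<close>, only row \<open>n\<close> has a band
    reaching this column.\<close>
  have "C (N - 1) = msum p (\<lambda>i. ?Q i * \<omega> i (n + N)) {..n}"
    using N by (simp add: C_def)
  also have "\<dots> = ?Q n * \<omega> n (n + N)"
    by (rule msum_single) (auto simp: omega_above zeros)
  finally show ?last
    by (simp add: omega_lead ones)
qed

end

section \<open>Jets along adapted root polynomials\<close>

text \<open>Translation by \<open>z\<close> turns the Taylor coefficients of \<open>f\<close> into
  the coefficients of \<open>g\<close>, for which the remainder is visibly divisible by the n-th
  power of the variable; translating back gives the claim.\<close>

lemma taylor_dvd:
  fixes f :: "'a::field_char_0 poly"
  shows "[:- z, 1:] ^ n dvd
    f - (\<Sum>r<n. [:poly ((pderiv ^^ r) f) z / fact r:] * [:- z, 1:] ^ r)"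
proof -
  define g where "g = f \<circ>\<^sub>p [:z, 1:]"
  have f: "f = g \<circ>\<^sub>p [:- z, 1:]"
    by (simp add: g_def pcompose_assoc [symmetric] pcompose_pCons)
  have comp: "(pderiv ^^ r) g = (pderiv ^^ r) f \<circ>\<^sub>p [:z, 1:]" for r
    by (induction r) (simp_all add: g_def pderiv_pcompose pderiv_pCons)
  have "poly ((pderiv ^^ r) f) z = poly ((pderiv ^^ r) g) 0" for r
    by (simp add: comp poly_pcompose)
  also have "poly ((pderiv ^^ r) g) 0 = fact r * coeff g r" for r
    by (simp add: poly_0_coeff_0 coeff_higher_pderiv pochhammer_fact)
  finally have coeff: "poly ((pderiv ^^ r) f) z / fact r = coeff g r" for r
    by simp
  have "monom 1 n dvd g - (\<Sum>r<n. monom (coeff g r) r)"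
    by (auto simp: monom_1_dvd_iff' coeff_sum)
  then obtain q where q: "g - (\<Sum>r<n. monom (coeff g r) r) = monom 1 n * q" ..
  have m: "monom c r \<circ>\<^sub>p [:- z, 1:] = [:c:] * [:- z, 1:] ^ r" for c r
  proof (induction r)
    case (Suc r)
    then show ?case
      by (simp only: monom_Suc pcompose_pCons power_Suc pCons_0_0 add_0_left mult.left_commute)
  qed (simp add: monom_0)
  have "f - (\<Sum>r<n. [:poly ((pderiv ^^ r) f) z / fact r:] * [:- z, 1:] ^ r) =
      (g - (\<Sum>r<n. monom (coeff g r) r)) \<circ>\<^sub>p [:- z, 1:]"
    by (simp only: coeff pcompose_diff pcompose_sum m f [symmetric])
  also have "\<dots> = [:- z, 1:] ^ n * (q \<circ>\<^sub>p [:- z, 1:])"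
    using m [of 1 n] by (simp add: q pcompose_mult)
  finally show ?thesis by simp
qed

lemma pderiv_dvd_power:
  fixes f :: "'a::field_char_0 poly"
  assumes "g ^ Suc n dvd f"
  shows "g ^ n dvd pderiv f"
proof -
  from assms obtain h where "f = g ^ Suc n * h" ..
  then have "pderiv f = g ^ n * (g * pderiv h + Polynomial.smult (of_nat (Suc n)) (pderiv g * h))"
    by (simp only: pderiv_mult pderiv_power_Suc) (simp add: algebra_simps)
  then show ?thesis by simp
qed

text \<open>Each derivative lowers the order of a zero by at most one, so a positive order
  \<open>n - r\<close> remains.\<close>

lemma higher_pderiv_root:
  fixes f :: "'a::field_char_0 poly"
  assumes "[:- z, 1:] ^ n dvd f" "r < n"
  shows "poly ((pderiv ^^ r) f) z = 0"
proof -
  have "[:- z, 1:] ^ (n - r) dvd (pderiv ^^ r) f"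
    using assms(2)
  proof (induction r)
    case (Suc r)
    then have "[:- z, 1:] ^ Suc (n - Suc r) dvd (pderiv ^^ r) f"
      by (simp add: Suc_diff_Suc)
    then show ?case by (simp only: funpow.simps comp_apply pderiv_dvd_power)
  qed (use assms in simp)
  with dvd_power [of "n - r" "[:- z, 1:]"] assms(2) have "[:- z, 1:] dvd (pderiv ^^ r) f"
    by (auto intro: dvd_trans)
  then show ?thesis by (simp add: poly_eq_0_iff_dvd)
qed

lemma adapted_root_poly_carrier [simp]: "adapted_root_poly p W z v \<in> carrier_vec p"
  by (simp add: adapted_root_poly_def)

lemma dim_adapted_root_poly [simp]: "dim_vec (adapted_root_poly p W z v) = p"
  by (simp add: adapted_root_poly_def)

text \<open>The truncation agrees with \<open>v\<close> modulo the power of x - z given by the root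
  order, so applying W to it keeps the order that W v has at \<open>z\<close>.\<close>

lemma adapted_root_poly_order:
  assumes W: "W \<in> carrier_mat p p" and v: "v \<in> carrier_vec p" and a: "a < p"
  shows "[:- z, 1:] ^ root_order W z v dvd (W *\<^sub>v adapted_root_poly p W z v) $ a"
proof -
  define n where "n = root_order W z v"
  let ?X = "[:- z, 1:] ^ n"
  have v_dvd: "?X dvd (W *\<^sub>v v) $ a"
  \<comment> \<open>For \<open>n = Suc m\<close>, minimality excludes \<open>m\<close> from the
    predicate under \<open>LEAST\<close>; as that predicate speaks of the exponent
    \<open>Suc m\<close>, this is divisibility by the n-th power.\<close>
  proof (cases n)
    case (Suc m)
    then have "m < (LEAST n. \<exists>a<dim_vec (W *\<^sub>v v). \<not> [:- z, 1:] ^ Suc n dvd (W *\<^sub>v v) $ a)"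
      by (simp add: n_def root_order_def vec_order_def)
    from not_less_Least [OF this] show ?thesis
      using W a Suc by auto
  qed auto
  have diff: "?X dvd v $ b - adapted_root_poly p W z v $ b" if "b < p" for b
    using that taylor_dvd by (simp add: adapted_root_poly_def n_def)
  have "(W *\<^sub>v v) $ a - (W *\<^sub>v adapted_root_poly p W z v) $ a =
      (\<Sum>b = 0..<p. W $$ (a, b) * (v $ b - adapted_root_poly p W z v $ b))"
    using W v a
    by (simp add: scalar_prod_def sum_subtractf right_diff_distrib)
  then have "?X dvd (W *\<^sub>v v) $ a - (W *\<^sub>v adapted_root_poly p W z v) $ a"
    using diff by (auto intro!: dvd_sum)
  from dvd_diff [OF v_dvd this] show ?thesis
    by (simp add: n_def)
qed

text \<open>The column labels of \<open>root_jet\<close> in their order. The number of columns is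
  the length of this list; that it equals N p is not built in.\<close>

definition root_index :: "nat \<Rightarrow> complex poly mat \<Rightarrow> complex list \<Rightarrow>
    (complex \<Rightarrow> nat \<Rightarrow> complex poly vec) \<Rightarrow> (complex \<times> nat \<times> nat) list" where
  "root_index p W zs v = [(z, j, r).
     z \<leftarrow> zs, j \<leftarrow> [0..<kernel_dim (pmat_at W z)], r \<leftarrow> [0..<root_order W z (v z j)]]"

lemma root_index_nth:
  assumes "b < length (root_index p W zs v)" "root_index p W zs v ! b = (z, j, r)"
  shows "z \<in> set zs" "j < kernel_dim (pmat_at W z)" "r < root_order W z (v z j)"
proof -
  have "(z, j, r) \<in> set (root_index p W zs v)"
    using assms by (metis nth_mem)
  then show "z \<in> set zs" "j < kernel_dim (pmat_at W z)" "r < root_order W z (v z j)"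
    by (auto simp: root_index_def)
qed

lemma root_jet_altdef:
  "root_jet p W zs v F = mat_of_cols p (map (\<lambda>(z, j, r).
     pvec_at (map_vec (pderiv ^^ r) (F *\<^sub>v adapted_root_poly p W z (v z j))) z)
     (root_index p W zs v))"
  by (simp add: root_jet_def root_index_def map_concat comp_def)

lemma root_jet_carrier [simp]:
  "root_jet p W zs v F \<in> carrier_mat p (length (root_index p W zs v))"
  by (rule carrier_matI) (simp_all add: root_jet_altdef)

lemma root_jet_index:
  assumes "F \<in> carrier_mat p p" "a < p" "b < length (root_index p W zs v)"
    "root_index p W zs v ! b = (z, j, r)"
  shows "root_jet p W zs v F $$ (a, b) =
    poly ((pderiv ^^ r) (\<Sum>c<p. F $$ (a, c) * adapted_root_poly p W z (v z j) $ c)) z"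
  using assms
  by (simp add: root_jet_altdef mat_of_cols_index pvec_at_def scalar_prod_def atLeast0LessThan)

text \<open>The jets annihilate \<open>G W\<close>, because \<open>W\<close> maps an adapted root polynomial of order \<open>n\<close> at \<open>z\<close>
  into the multiples of \<open>(x - z)\<^sup>n\<close>.\<close>

lemma root_jet_relation:
  fixes N :: nat
  assumes W: "W \<in> carrier_mat p p"
    and v: "\<And>z j. z \<in> set zs \<Longrightarrow> j < kernel_dim (pmat_at W z) \<Longrightarrow> v z j \<in> carrier_vec p"
    and F: "\<And>l. F l \<in> carrier_mat p p" and R: "R \<in> carrier_mat p p" and G: "G \<in> carrier_mat p p"
    and C: "\<And>l. C l \<in> carrier_mat p p"
    and rel: "\<And>x. pmat_at G x * pmat_at W x =
      pmat_at R x + msum p (\<lambda>l. C l * pmat_at (F l) x) {..<N}"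
    and a: "a < p" and b: "b < length (root_index p W zs v)"
  shows "root_jet p W zs v R $$ (a, b) + (\<Sum>l<N. (C l * root_jet p W zs v (F l)) $$ (a, b)) = 0"
proof -
  obtain z j r where zjr: "root_index p W zs v ! b = (z, j, r)"
    by (metis prod_cases3)
  note index = root_index_nth [OF b zjr]
  define u where "u = adapted_root_poly p W z (v z j)"
  have [simp]: "dim_vec u = p"
    by (simp add: u_def)
  \<comment> \<open>Column \<open>b\<close> of a jet is \<open>J\<close> applied to the product with
    \<open>u\<close>. Since \<open>J\<close> is linear, it carries the relation between polynomials
    over to the jets.\<close>
  define J where "J = (\<lambda>f. poly ((pderiv ^^ r) f) z)"
  have J: "J (f + g) = J f + J g" "J (sum h I) = (\<Sum>i\<in>I. J (h i))" "J (Polynomial.smult c f) = c * J f"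
    for f g c and h :: "nat \<Rightarrow> complex poly" and I
    by (simp_all add: J_def higher_pderiv_add higher_pderiv_sum higher_pderiv_smult poly_sum)
  have jet: "root_jet p W zs v E $$ (c, b) = J (\<Sum>d<p. E $$ (c, d) * u $ d)"
    if "E \<in> carrier_mat p p" "c < p" for E c
    using root_jet_index [OF that b zjr] by (simp add: J_def u_def)
  \<comment> \<open>Both sides agree at every complex point, hence are equal as polynomials.\<close>
  have *: "(\<Sum>c<p. G $$ (a, c) * W $$ (c, d)) =
      R $$ (a, d) + (\<Sum>l<N. \<Sum>c<p. Polynomial.smult (C l $$ (a, c)) (F l $$ (c, d)))" (is "?l = ?r")
    if d: "d < p" for d
  proof -
    have "poly ?l x = poly ?r x" for x
    proof -
      have "poly ?l x = (pmat_at G x * pmat_at W x) $$ (a, d)"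
        using G W a d by (simp add: pmat_at_def scalar_prod_def poly_sum atLeast0LessThan)
      also have "\<dots> = poly (R $$ (a, d)) x + (\<Sum>l<N. (C l * pmat_at (F l) x) $$ (a, d))"
        using R a d by (simp add: rel msum_index) (simp add: pmat_at_def)
      also have "\<dots> = poly ?r x"
        using a d
        by (simp add: carrier_matD [OF F] carrier_matD [OF C] pmat_at_def scalar_prod_def poly_sum atLeast0LessThan)
      finally show ?thesis .
    qed
    then show ?thesis by (intro poly_eq_poly_eq_iff [THEN iffD1]) auto
  qed
  have "root_jet p W zs v R $$ (a, b) + (\<Sum>l<N. (C l * root_jet p W zs v (F l)) $$ (a, b)) =
      J (\<Sum>d<p. R $$ (a, d) * u $ d) + (\<Sum>l<N. \<Sum>c<p. C l $$ (a, c) * J (\<Sum>d<p. F l $$ (c, d) * u $ d))"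
    using a b
    by (simp add: carrier_matD [OF C] carrier_matD [OF root_jet_carrier] jet R F scalar_prod_def atLeast0LessThan)
  also have "\<dots> = J ((\<Sum>d<p. R $$ (a, d) * u $ d) +
      (\<Sum>l<N. \<Sum>c<p. Polynomial.smult (C l $$ (a, c)) (\<Sum>d<p. F l $$ (c, d) * u $ d)))"
    by (simp only: J)
  also have "(\<Sum>d<p. R $$ (a, d) * u $ d) +
      (\<Sum>l<N. \<Sum>c<p. Polynomial.smult (C l $$ (a, c)) (\<Sum>d<p. F l $$ (c, d) * u $ d)) =
    (\<Sum>d<p. (R $$ (a, d) + (\<Sum>l<N. \<Sum>c<p. Polynomial.smult (C l $$ (a, c)) (F l $$ (c, d)))) * u $ d)"
  proof -
    have smult: "Polynomial.smult c f = [:c:] * f" for c and f :: "complex poly" by simp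
    have "(\<Sum>l<N. \<Sum>c<p. Polynomial.smult (C l $$ (a, c)) (\<Sum>d<p. F l $$ (c, d) * u $ d)) =
        (\<Sum>l<N. \<Sum>d<p. \<Sum>c<p. Polynomial.smult (C l $$ (a, c)) (F l $$ (c, d)) * u $ d)"
      by (rule sum.cong [OF refl], subst sum.swap) (simp only: smult sum_distrib_left mult.assoc)
    also have "\<dots> = (\<Sum>d<p. \<Sum>l<N. \<Sum>c<p. Polynomial.smult (C l $$ (a, c)) (F l $$ (c, d)) * u $ d)"
      by (rule sum.swap)
    finally show ?thesis
      by (simp add: distrib_right sum.distrib sum_distrib_right)
  qed
  also have "\<dots> = (\<Sum>d<p. (\<Sum>c<p. G $$ (a, c) * W $$ (c, d)) * u $ d)"
    by (simp add: *)
  also have "\<dots> = (\<Sum>c<p. G $$ (a, c) * (W *\<^sub>v u) $ c)"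
  proof -
    have "(\<Sum>d<p. (\<Sum>c<p. G $$ (a, c) * W $$ (c, d)) * u $ d) =
        (\<Sum>c<p. \<Sum>d<p. G $$ (a, c) * W $$ (c, d) * u $ d)"
      by (simp add: sum_distrib_right) (rule sum.swap)
    then show ?thesis
      using carrier_matD [OF W]
      by (simp add: scalar_prod_def atLeast0LessThan sum_distrib_left mult.assoc)
  qed
  also have "J \<dots> = 0"
    unfolding J_def u_def
    by (intro higher_pderiv_root [OF _ index(3)] dvd_sum dvd_mult
        adapted_root_poly_order [OF W v [OF index(1,2)]]) simp
  finally show ?thesis .
qed

section \<open>Last quasideterminants\<close>

text \<open>A nonzero determinant makes \<open>mat_inverse\<close> return \<open>Some\<close>, so
  \<open>the\<close> in \<open>minv\<close> yields the actual inverse.\<close>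

lemma minv:
  fixes A :: "'a::field mat"
  assumes A: "A \<in> carrier_mat n n" and "det A \<noteq> 0"
  shows "minv A \<in> carrier_mat n n" "A * minv A = 1\<^sub>m n" "minv A * A = 1\<^sub>m n"
proof -
  \<comment> \<open>The unit \<open>()\<close> fills the free extension slot of the matrix ring
    record, so that both facts speak of the same ring.\<close>
  obtain B where "mat_inverse A = Some B"
    using mat_inverse(1) [OF A, of "()"] det_non_zero_imp_unit [OF assms, of "()"] by blast
  with mat_inverse(2) [OF A this] show "minv A \<in> carrier_mat n n"
      "A * minv A = 1\<^sub>m n" "minv A * A = 1\<^sub>m n"
    by (simp_all add: minv_def)
qed

text \<open>Companion of \<open>block_col\<close>: a combination of blocks with matrix coefficients
  becomes one matrix product.\<close>

definition block_row :: "nat \<Rightarrow> nat \<Rightarrow> (nat \<Rightarrow> 'a mat) \<Rightarrow> 'a mat" where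
  "block_row p N C = mat p (N * p) (\<lambda>(a, j). C (j div p) $$ (a, j mod p))"

lemma block_row_carrier [simp]: "block_row p N C \<in> carrier_mat p (N * p)"
  by (simp add: block_row_def)

lemma dim_block_row [simp]: "dim_row (block_row p N C) = p" "dim_col (block_row p N C) = N * p"
  by (simp_all add: block_row_def)

lemma block_row_mult_block_col:
  fixes C Y :: "nat \<Rightarrow> 'a::semiring_0 mat"
  assumes C: "\<And>l. C l \<in> carrier_mat p p" and Y: "\<And>l. Y l \<in> carrier_mat p q"
    and ab: "a < p" "b < q"
  shows "(block_row p N C * block_col p N Y) $$ (a, b) = (\<Sum>l<N. (C l * Y l) $$ (a, b))"
proof -
  let ?f = "\<lambda>j. C (j div p) $$ (a, j mod p) * Y (j div p) $$ (j mod p, b)"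
  have "(block_row p N C * block_col p N Y) $$ (a, b) = (\<Sum>j<N * p. ?f j)"
    using ab Y [of 0] by (simp add: block_row_def block_col_def scalar_prod_def atLeast0LessThan)
  also have "\<dots> = (\<Sum>l<N. \<Sum>j = l * p..<l * p + p. ?f j)"
    by (rule sum.nat_group [symmetric])
  also have "\<dots> = (\<Sum>l<N. \<Sum>c<p. C l $$ (a, c) * Y l $$ (c, b))"
  proof (rule sum.cong [OF refl])
    fix l
    have "(\<Sum>j = l * p..<l * p + p. ?f j) = (\<Sum>c = 0..<p. ?f (c + l * p))"
      using sum.shift_bounds_nat_ivl [of ?f 0 "l * p" p] by (simp add: add.commute)
    then show "(\<Sum>j = l * p..<l * p + p. ?f j) = (\<Sum>c<p. C l $$ (a, c) * Y l $$ (c, b))"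
      by (simp add: atLeast0LessThan)
  qed
  also have "\<dots> = (\<Sum>l<N. (C l * Y l) $$ (a, b))"
    using ab
    by (simp add: carrier_matD [OF C] carrier_matD [OF Y] scalar_prod_def atLeast0LessThan)
  finally show ?thesis .
qed

text \<open>With C the row of coefficients, \<open>rel\<close> says R = -C Y, so R times the inverse
  of Y is -C whatever the right-hand column \<open>B\<close> is. The quasideterminant thus evaluates
  the combination with these coefficients at \<open>B\<close>.\<close>

lemma last_quasidet_eq:
  fixes C Y B :: "nat \<Rightarrow> 'a::field mat"
  assumes C: "\<And>l. C l \<in> carrier_mat p p" and Y: "\<And>l. Y l \<in> carrier_mat p q"
    and B: "\<And>l. B l \<in> carrier_mat p p" and D: "D \<in> carrier_mat p p" and R: "R \<in> carrier_mat p q"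
    and det: "det (block_col p N Y) \<noteq> 0"
    and rel: "\<And>a b. a < p \<Longrightarrow> b < q \<Longrightarrow> R $$ (a, b) + (\<Sum>l<N. (C l * Y l) $$ (a, b)) = 0"
  shows "last_quasidet (block_col p N Y) (block_col p N B) R D =
    D + msum p (\<lambda>l. C l * B l) {..<N}"
proof -
  let ?Y = "block_col p N Y" and ?B = "block_col p N B" and ?C = "block_row p N C"
  have dims: "?Y \<in> carrier_mat (N * p) q" "?B \<in> carrier_mat (N * p) p"
    using Y [of 0] B [of 0] by (simp_all add: block_col_def)
  \<comment> \<open>The determinant of a non-square matrix is \<open>0\<close> by convention; this is how the sum of the orders of
    the root polynomials is seen to be \<open>N p\<close>.\<close>
  with det have q: "q = N * p"
    by (auto simp: det_def split: if_splits)
  note inv = minv [OF dims(1) [unfolded q] det]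
  have "R = - (?C * ?Y)"
  proof (rule eq_matI)
    fix a b assume "a < dim_row (- (?C * ?Y))" "b < dim_col (- (?C * ?Y))"
    then have ab: "a < p" "b < q" using dims by auto
    have "(- (?C * ?Y)) $$ (a, b) = - (?C * ?Y) $$ (a, b)"
      using dims ab by (intro index_uminus_mat) auto
    also have "\<dots> = - (\<Sum>l<N. (C l * Y l) $$ (a, b))"
      by (simp only: block_row_mult_block_col [OF C Y ab])
    finally show "R $$ (a, b) = (- (?C * ?Y)) $$ (a, b)"
      using rel [OF ab] by (simp only: add_eq_0_iff2)
  qed (use R dims in auto)
  also have "- (?C * ?Y) = - ?C * ?Y"
    using dims by simp
  finally have "R * minv ?Y * ?B = - ?C * ?Y * minv ?Y * ?B"
    by simp
  also have "- ?C * ?Y * minv ?Y = - ?C * (?Y * minv ?Y)"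
    using dims(1) inv(1) q by (intro assoc_mult_mat) auto
  also have "\<dots> = - ?C"
    unfolding inv(2) by (intro right_mult_one_mat [of _ p]) simp
  also have "- ?C * ?B = - (?C * ?B)"
    using dims(2) by simp
  finally have "R * minv ?Y * ?B = - (?C * ?B)" .
  also have "?C * ?B = msum p (\<lambda>l. C l * B l) {..<N}"
  proof (rule eq_matI)
    fix a b
    assume "a < dim_row (msum p (\<lambda>l. C l * B l) {..<N})" "b < dim_col (msum p (\<lambda>l. C l * B l) {..<N})"
    then have "a < p" "b < p" by auto
    then show "(?C * ?B) $$ (a, b) = msum p (\<lambda>l. C l * B l) {..<N} $$ (a, b)"
      by (simp only: block_row_mult_block_col [OF C B] msum_index)
  qed (use dims in auto)
  finally have *: "R * minv ?Y * ?B = - msum p (\<lambda>l. C l * B l) {..<N}" .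
  show ?thesis
    unfolding last_quasidet_def * using D by (intro eq_matI) auto
qed

section \<open>The complexified data\<close>

lemma cmat_carrier [simp]: "A \<in> carrier_mat n m \<Longrightarrow> cmat A \<in> carrier_mat n m"
  by (simp add: cmat_def)

lemma cmat_mult: "A \<in> carrier_mat n m \<Longrightarrow> B \<in> carrier_mat m k \<Longrightarrow> cmat (A * B) = cmat A * cmat B"
  unfolding cmat_def by (rule of_real_hom.mat_hom_mult)

lemma cmat_one [simp]: "cmat (1\<^sub>m n) = 1\<^sub>m n"
  unfolding cmat_def by (rule of_real_hom.mat_hom_one)

lemma cmat_zero [simp]: "cmat (0\<^sub>m n m) = 0\<^sub>m n m"
  by (rule eq_matI) (auto simp: cmat_def)

lemma cmat_transpose: "cmat (transpose_mat A) = transpose_mat (cmat A)"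
  by (rule eq_matI) (auto simp: cmat_def)

lemma cmat_msum:
  "(\<And>i. i \<in> I \<Longrightarrow> F i \<in> carrier_mat p p) \<Longrightarrow> cmat (msum p F I) = msum p (\<lambda>i. cmat (F i)) I"
  unfolding cmat_def by (rule map_mat_msum) auto

lemma map_poly_of_real_add:
  "map_poly complex_of_real (f + g) = map_poly complex_of_real f + map_poly complex_of_real g"
  by (rule poly_eqI) (simp add: coeff_map_poly)

lemma poly_of_real_sum_monom:
  "finite I \<Longrightarrow> poly (map_poly complex_of_real (\<Sum>j\<in>I. monom (c j) j)) x = (\<Sum>j\<in>I. x ^ j * of_real (c j))"
  by (induction I rule: finite_induct)
    (simp_all add: map_poly_of_real_add map_poly_monom poly_monom mult.commute)

lemma biorth_poly_carrier [simp]: "cpmat (biorth_poly p S k) \<in> carrier_mat p p"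
  by (simp add: cpmat_def biorth_poly_def)

text \<open>Passes from the real polynomial matrices of the statement to the values of complexified
  ones, to which the algebraic locale applies.\<close>

lemma biorth_poly_at:
  assumes "\<And>i j. S i j \<in> carrier_mat p p"
  shows "pmat_at (cpmat (biorth_poly p S k)) x = tri_poly p (\<lambda>i j. cmat (S i j)) k x"
proof (rule eq_matI)
  fix a b assume "a < dim_row (tri_poly p (\<lambda>i j. cmat (S i j)) k x)"
    "b < dim_col (tri_poly p (\<lambda>i j. cmat (S i j)) k x)"
  then show "pmat_at (cpmat (biorth_poly p S k)) x $$ (a, b) =
      tri_poly p (\<lambda>i j. cmat (S i j)) k x $$ (a, b)"
    by (simp add: tri_poly_def pmat_at_def cpmat_def biorth_poly_def msum_index
        carrier_matD [OF assms] poly_of_real_sum_monom cmat_def)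
qed (auto simp: tri_poly_def pmat_at_def cpmat_def biorth_poly_def)

lemma CD_kernel_carrier [simp]: "CD_kernel p S1 H S2 n y \<in> carrier_mat p p"
  by (simp add: CD_kernel_def)

lemma pmat_at_mult:
  assumes "A \<in> carrier_mat p q" "B \<in> carrier_mat q r"
  shows "pmat_at (map_mat (\<lambda>c. [:c:]) A * B) x = A * pmat_at B x"
  using assms by (intro eq_matI) (auto simp: pmat_at_def scalar_prod_def poly_sum)

lemma CD_kernel_at:
  assumes S1: "\<And>i j. S1 i j \<in> carrier_mat p p" and S2: "\<And>i j. S2 i j \<in> carrier_mat p p"
    and H: "\<And>k. minv (H k) \<in> carrier_mat p p"
  shows "pmat_at (CD_kernel p S1 H S2 n y) x = msum p (\<lambda>k.
    transpose_mat (tri_poly p (\<lambda>i j. cmat (S2 i j)) k y) * cmat (minv (H k)) *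
    tri_poly p (\<lambda>i j. cmat (S1 i j)) k x) {..n}"
proof -
  let ?A = "\<lambda>k. transpose_mat (tri_poly p (\<lambda>i j. cmat (S2 i j)) k y) * cmat (minv (H k))"
  have A: "?A k \<in> carrier_mat p p" for k
    using H by (intro mult_carrier_mat [of _ p p]) auto
  have "pmat_at (CD_kernel p S1 H S2 n y) x = msum p (\<lambda>k.
      pmat_at (map_mat (\<lambda>c. [:c:]) (?A k) * cpmat (biorth_poly p S1 k)) x) {..n}"
    \<comment> \<open>The values at \<open>y\<close> are rewritten before \<open>pmat_at\<close> is
      unfolded, so that only the evaluation at \<open>x\<close> is opened; it is additive and passes
      through the sum.\<close>
    unfolding CD_kernel_def biorth_poly_at [OF S2] unfolding pmat_at_def
    using A by (intro map_mat_msum mult_carrier_mat [of _ p p]) auto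
  then show ?thesis
    by (simp add: pmat_at_mult [OF A biorth_poly_carrier] biorth_poly_at [OF S1])
qed

lemma monic_pmat_coeff:
  assumes "monic_pmat p N W"
  shows "W \<in> carrier_mat p p" "map_mat (\<lambda>f. coeff f N) W = 1\<^sub>m p"
    "a < p \<Longrightarrow> b < p \<Longrightarrow> degree (W $$ (a, b)) \<le> N"
proof -
  show W: "W \<in> carrier_mat p p" and "map_mat (\<lambda>f. coeff f N) W = 1\<^sub>m p"
    using assms by (auto simp: monic_pmat_def)
  assume ab: "a < p" "b < p"
  show "degree (W $$ (a, b)) \<le> N"
  proof (rule degree_le, intro allI impI)
    fix n assume "N < n"
    then have "map_mat (\<lambda>f. coeff f n) W $$ (a, b) = 0\<^sub>m p p $$ (a, b)"
      using assms by (simp add: monic_pmat_def)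
    then show "coeff (W $$ (a, b)) n = 0" using ab W by simp
  qed
qed

lemma monic_pmat_at:
  assumes "monic_pmat p N W"
  shows "pmat_at (cpmat W) x =
    msum p (\<lambda>l. x ^ l \<cdot>\<^sub>m cmat (map_mat (\<lambda>f. coeff f l) W)) {..N}"
proof (rule eq_matI)
  note W = monic_pmat_coeff [OF assms]
  fix a b assume "a < dim_row (msum p (\<lambda>l. x ^ l \<cdot>\<^sub>m cmat (map_mat (\<lambda>f. coeff f l) W)) {..N})"
    "b < dim_col (msum p (\<lambda>l. x ^ l \<cdot>\<^sub>m cmat (map_mat (\<lambda>f. coeff f l) W)) {..N})"
  then have ab: "a < p" "b < p" by auto
  have "poly (map_poly complex_of_real (W $$ (a, b))) x =
      poly (map_poly complex_of_real (\<Sum>l\<le>N. monom (coeff (W $$ (a, b)) l) l)) x"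
    using W(3) [OF ab] by (simp add: poly_as_sum_of_monoms')
  then show "pmat_at (cpmat W) x $$ (a, b) =
      msum p (\<lambda>l. x ^ l \<cdot>\<^sub>m cmat (map_mat (\<lambda>f. coeff f l) W)) {..N} $$ (a, b)"
    using ab W(1) by (simp add: pmat_at_def cpmat_def cmat_def msum_index poly_of_real_sum_monom)
qed (use monic_pmat_coeff(1) [OF assms] in \<open>auto simp: pmat_at_def cpmat_def\<close>)

section \<open>Moments of the perturbed matrix of measures\<close>

lemma moment_matrix_index:
  assumes "a < p" "b < p"
  shows "moment_matrix p \<mu> i j $$ (a, b) = signed_integral (\<mu> a b) (\<lambda>x. x ^ (i + j))"
proof -
  have "moment_matrix p \<mu> i j $$ (a, b) =
      (\<Sum>c<p. signed_integral (\<mu> c b) (\<lambda>x. (x ^ (i + j) \<cdot>\<^sub>m 1\<^sub>m p) $$ (a, c)))"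
    using assms by (simp add: moment_matrix_def matrix_integral_def)
  \<comment> \<open>Off the diagonal of the identity matrix the integrand is zero.\<close>
  also have "\<dots> = (\<Sum>c<p. if c = a then signed_integral (\<mu> a b) (\<lambda>x. x ^ (i + j)) else 0)"
    using assms by (intro sum.cong) (auto simp: signed_integral_def)
  finally show ?thesis using assms by simp
qed

lemma signed_integral_sum:
  assumes "finite_moments p \<mu>" "a < p" "b < p"
  shows "signed_integral (\<mu> a b) (\<lambda>x. \<Sum>l\<in>I. c l * x ^ k l) =
    (\<Sum>l\<in>I. c l * signed_integral (\<mu> a b) (\<lambda>x. x ^ k l))"
proof -
  have "integrable (fst (\<mu> a b)) (\<lambda>x. x ^ n)" "integrable (snd (\<mu> a b)) (\<lambda>x. x ^ n)" for n
    using assms by (auto simp: finite_moments_def)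
  then show ?thesis
    by (simp add: signed_integral_def right_diff_distrib sum_subtractf)
qed

text \<open>M' = W(\<Lambda>) M: a factor of degree \<open>l\<close> standing to the left of the
  measure moves the row index from \<open>i\<close> to \<open>i + l\<close>. Linearity of the
  integral rests on the finiteness of all moments.\<close>

lemma perturbed_moment_matrix_shift:
  assumes monic: "monic_pmat p N W" and \<mu>: "finite_moments p \<mu>"
  shows "perturbed_moment_matrix p W \<mu> i j =
    msum p (\<lambda>l. map_mat (\<lambda>f. coeff f l) W * moment_matrix p \<mu> (i + l) j) {..N}"
proof (rule eq_matI)
  note W = monic_pmat_coeff [OF monic]
  let ?R = "msum p (\<lambda>l. map_mat (\<lambda>f. coeff f l) W * moment_matrix p \<mu> (i + l) j) {..N}"
  fix a b assume "a < dim_row ?R" "b < dim_col ?R"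
  then have ab: "a < p" "b < p" by auto
  let ?m = "\<lambda>c l. signed_integral (\<mu> c b) (\<lambda>x. x ^ (i + l + j))"
  have "perturbed_moment_matrix p W \<mu> i j $$ (a, b) =
      (\<Sum>c<p. signed_integral (\<mu> c b) (\<lambda>x. x ^ (i + j) * poly (W $$ (a, c)) x))"
    using ab W(1) by (simp add: perturbed_moment_matrix_def matrix_integral_def pmat_at_def)
  also have "\<dots> = (\<Sum>c<p. \<Sum>l\<le>N. coeff (W $$ (a, c)) l * ?m c l)"
  proof (rule sum.cong [OF refl])
    fix c assume "c \<in> {..<p}"
    then have c: "c < p" by simp
    have "poly (W $$ (a, c)) x = (\<Sum>l\<le>N. coeff (W $$ (a, c)) l * x ^ l)" for x
      by (subst poly_as_sum_of_monoms' [OF W(3) [OF ab(1) c], symmetric])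
        (simp add: poly_sum poly_monom)
    then have "(\<lambda>x. x ^ (i + j) * poly (W $$ (a, c)) x) =
        (\<lambda>x. \<Sum>l\<le>N. coeff (W $$ (a, c)) l * x ^ (i + l + j))"
      by (simp add: fun_eq_iff sum_distrib_left power_add mult_ac)
    then show "signed_integral (\<mu> c b) (\<lambda>x. x ^ (i + j) * poly (W $$ (a, c)) x) =
        (\<Sum>l\<le>N. coeff (W $$ (a, c)) l * ?m c l)"
      by (simp add: signed_integral_sum [OF \<mu> c ab(2)])
  qed
  also have "\<dots> = (\<Sum>l\<le>N. \<Sum>c<p. coeff (W $$ (a, c)) l * ?m c l)"
    by (rule sum.swap)
  also have "\<dots> = (\<Sum>l\<le>N. (map_mat (\<lambda>f. coeff f l) W * moment_matrix p \<mu> (i + l) j) $$ (a, b))"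
  proof (rule sum.cong [OF refl])
    fix l
    have "moment_matrix p \<mu> (i + l) j \<in> carrier_mat p p"
      by (simp add: moment_matrix_def matrix_integral_def)
    then show "(\<Sum>c<p. coeff (W $$ (a, c)) l * ?m c l) =
        (map_mat (\<lambda>f. coeff f l) W * moment_matrix p \<mu> (i + l) j) $$ (a, b)"
      using ab W(1) by (auto simp: scalar_prod_def atLeast0LessThan moment_matrix_index)
  qed
  finally show "perturbed_moment_matrix p W \<mu> i j $$ (a, b) = ?R $$ (a, b)"
    using ab by (simp add: msum_index)
qed (simp_all add: perturbed_moment_matrix_def matrix_integral_def)

section \<open>Transfer of the factorizations to complex matrices\<close>

lemma lower_unitriangular_inverse_cmat:
  assumes "lower_unitriangular_inverse p S L"
  shows "tri_inverse p (\<lambda>i j. cmat (S i j)) (\<lambda>i j. cmat (L i j))"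
proof -
  note 1 = assms [unfolded lower_unitriangular_inverse_def lower_unitriangular_def]
  have S: "S i j \<in> carrier_mat p p" and L: "L i j \<in> carrier_mat p p" for i j
    using 1 by auto
  have "msum p (\<lambda>k. cmat (S i k) * cmat (L k j)) {..i} = cmat (msum p (\<lambda>k. S i k * L k j) {..i})"
    "msum p (\<lambda>k. cmat (L i k) * cmat (S k j)) {..i} = cmat (msum p (\<lambda>k. L i k * S k j) {..i})" for i j
    by (simp_all add: cmat_msum cmat_mult [OF S L] cmat_mult [OF L S]
        mult_carrier_mat [OF S L] mult_carrier_mat [OF L S])
  with 1 show ?thesis
    by (auto simp: tri_inverse_def)
qed

lemma gauss_borel_cmat:
  assumes "gauss_borel p M S1 H S2"
  obtains L1 L2 where "tri_inverse p (\<lambda>i j. cmat (S1 i j)) L1" "tri_inverse p (\<lambda>i j. cmat (S2 i j)) L2"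
    "\<And>i j. cmat (M i j) = msum p (\<lambda>k. L1 i k * cmat (H k) * transpose_mat (L2 j k)) {..min i j}"
proof -
  obtain L1 L2 where L: "lower_unitriangular_inverse p S1 L1" "lower_unitriangular_inverse p S2 L2"
    and M: "\<And>i j. M i j = msum p (\<lambda>k. L1 i k * H k * transpose_mat (L2 j k)) {..min i j}"
    and H: "\<And>k. H k \<in> carrier_mat p p"
    using assms by (auto simp: gauss_borel_def)
  have c [simp]: "L1 i j \<in> carrier_mat p p" "L2 i j \<in> carrier_mat p p" for i j
    using L by (auto simp: lower_unitriangular_inverse_def lower_unitriangular_def)
  have "cmat (M i j) = msum p (\<lambda>k. cmat (L1 i k) * cmat (H k) * transpose_mat (cmat (L2 j k))) {..min i j}" for i j
    by (simp add: M cmat_msum cmat_mult [of _ p p _ p] H cmat_transpose mult_carrier_mat [of _ p p _ p])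
  with L [THEN lower_unitriangular_inverse_cmat] show ?thesis by (rule that)
qed

section \<open>The Christoffel formulas, from the connection relations and the jets\<close>

theorem theorem2:
  fixes p N :: nat
    and W :: "real poly mat"
    and \<mu> :: measure_matrix
    and S1 S2 S1' S2' :: "nat \<Rightarrow> nat \<Rightarrow> real mat"
    and H H' :: "nat \<Rightarrow> real mat"
    and zs :: "complex list"
    and v :: "complex \<Rightarrow> nat \<Rightarrow> complex poly vec"
  defines "P1 \<equiv> \<lambda>k x. pmat_at (cpmat (biorth_poly p S1 k)) x"
    and "P1' \<equiv> \<lambda>k x. pmat_at (cpmat (biorth_poly p S1' k)) x"
    and "P2' \<equiv> \<lambda>k x. pmat_at (cpmat (biorth_poly p S2' k)) x"
    and "\<pi> \<equiv> pi_mat p (cpmat W) zs v S1"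
    and "\<Pi>N \<equiv> \<lambda>k. Pi_mat p (cpmat W) zs v S1 k N"
    and "\<gamma> \<equiv> gamma_mat p (cpmat W) zs v S1 H S2"
  assumes "p \<ge> 1" and "N \<ge> 1"
    and "monic_pmat p N W"
    and "finite_moments p \<mu>"
    and "\<forall>k\<ge>1. det (block_trunc p k (moment_matrix p \<mu>)) \<noteq> 0"
    and "gauss_borel p (moment_matrix p \<mu>) S1 H S2"
    and "gauss_borel p (perturbed_moment_matrix p W \<mu>) S1' H' S2'"
    and "distinct zs" and "set zs = {z. poly (det (cpmat W)) z = 0}"
    and "\<forall>z\<in>set zs. canonical_root_polys p (cpmat W) z (v z)"
  shows "(\<forall>k. det (\<Pi>N k) \<noteq> 0 \<longrightarrow>
            (\<forall>x. P1' k x * pmat_at (cpmat W) x =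
               last_quasidet (\<Pi>N k) (block_col p N (\<lambda>l. P1 (k + l) x))
                             (\<pi> (k + N)) (P1 (k + N) x)) \<and>
            cmat (H' k) =
               last_quasidet (\<Pi>N k) (block_col p N (\<lambda>l. if l = 0 then cmat (H k) else 0\<^sub>m p p))
                             (\<pi> (k + N)) (0\<^sub>m p p)) \<and>
         (\<forall>k. det (\<Pi>N (k + 1)) \<noteq> 0 \<longrightarrow>
            (\<forall>x. transpose_mat (P2' k x) * cmat (minv (H' k)) =
               last_quasidet (\<Pi>N (k + 1)) (block_col p N (\<lambda>l. if l = N - 1 then 1\<^sub>m p else 0\<^sub>m p p))
                             (\<gamma> k x) (0\<^sub>m p p)))"
proof -
  note monic = monic_pmat_coeff [OF assms(9)]
  note gb = \<open>gauss_borel p (moment_matrix p \<mu>) S1 H S2\<close>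
  note gb' = \<open>gauss_borel p (perturbed_moment_matrix p W \<mu>) S1' H' S2'\<close>
  have H: "H k \<in> carrier_mat p p" "det (H k) \<noteq> 0" "H' k \<in> carrier_mat p p" "det (H' k) \<noteq> 0" for k
    using gb gb' by (auto simp: gauss_borel_def)
  have S: "S1 i j \<in> carrier_mat p p" "S2 i j \<in> carrier_mat p p"
    "S1' i j \<in> carrier_mat p p" "S2' i j \<in> carrier_mat p p" for i j
    using gb gb' by (auto simp: gauss_borel_def lower_unitriangular_inverse_def lower_unitriangular_def)
  note inv = minv [OF H(1,2)] and inv' = minv [OF H(3,4)]
  have moment: "moment_matrix p \<mu> i j \<in> carrier_mat p p" for i j
    by (simp add: moment_matrix_def matrix_integral_def)
  define A where "A = (\<lambda>l. map_mat (\<lambda>f. coeff f l) W)"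
  have A: "A l \<in> carrier_mat p p" "A N = 1\<^sub>m p" for l
    using monic(1,2) by (simp_all add: A_def)
  obtain L1 L2 where L:
    "tri_inverse p (\<lambda>i j. cmat (S1 i j)) L1" "tri_inverse p (\<lambda>i j. cmat (S2 i j)) L2"
    "\<And>i j. cmat (moment_matrix p \<mu> i j) =
      msum p (\<lambda>k. L1 i k * cmat (H k) * transpose_mat (L2 j k)) {..min i j}"
    by (rule gauss_borel_cmat [OF gb]) (rule that)
  obtain L1' L2' where L':
    "tri_inverse p (\<lambda>i j. cmat (S1' i j)) L1'" "tri_inverse p (\<lambda>i j. cmat (S2' i j)) L2'"
    "\<And>i j. cmat (perturbed_moment_matrix p W \<mu> i j) =
      msum p (\<lambda>k. L1' i k * cmat (H' k) * transpose_mat (L2' j k)) {..min i j}"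
    by (rule gauss_borel_cmat [OF gb']) (rule that)
  interpret C: christoffel p N "\<lambda>i j. cmat (S1 i j)" L1 "\<lambda>i j. cmat (S2 i j)" L2
    "\<lambda>i j. cmat (S1' i j)" L1' "\<lambda>i j. cmat (S2' i j)" L2'
    "\<lambda>i j. cmat (moment_matrix p \<mu> i j)" "\<lambda>i j. cmat (perturbed_moment_matrix p W \<mu> i j)"
    "\<lambda>k. cmat (H k)" "\<lambda>k. cmat (H' k)" "\<lambda>k. cmat (minv (H k))" "\<lambda>k. cmat (minv (H' k))"
    "\<lambda>l. cmat (A l)"
  proof
    have "perturbed_moment_matrix p W \<mu> i j =
        msum p (\<lambda>l. A l * moment_matrix p \<mu> (i + l) j) {..N}" for i j
      by (simp add: A_def perturbed_moment_matrix_shift [OF assms(9,10)])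
    then show "cmat (perturbed_moment_matrix p W \<mu> i j) =
        msum p (\<lambda>l. cmat (A l) * cmat (moment_matrix p \<mu> (i + l) j)) {..N}" for i j
      by (simp add: A(1) moment cmat_msum cmat_mult [of _ p p _ p] mult_carrier_mat [of _ p p _ p])
  qed (use L L' H A inv inv' in \<open>simp_all add: cmat_mult [of _ p p _ p, symmetric]\<close>)
  have W: "cpmat W \<in> carrier_mat p p"
    using monic(1) by (simp add: cpmat_def)
  have W_at: "pmat_at (cpmat W) x = C.W x" for x
    unfolding C.W_def by (simp add: A_def monic_pmat_at [OF assms(9)])
  have v: "v z j \<in> carrier_vec p" if "z \<in> set zs" "j < kernel_dim (pmat_at (cpmat W) z)" for z j
    using that assms(16) by (auto simp: canonical_root_polys_def root_poly_def)
  let ?J = "root_jet p (cpmat W) zs v"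
  \<comment> \<open>All three formulas have the shape treated next: a left multiple G W equals
    \<open>R\<close> plus a combination of the \<open>F l\<close>. The jets turn this into a linear
    system for the coefficients, and the quasideterminant evaluates the combination at
    \<open>B\<close>.\<close>
  let ?P = "\<lambda>k. cpmat (biorth_poly p S1 k)"
  have quasidet: "last_quasidet (block_col p N (\<lambda>l. ?J (F l))) (block_col p N B) (?J R) D =
      D + msum p (\<lambda>l. C l * B l) {..<N}"
    if "det (block_col p N (\<lambda>l. ?J (F l))) \<noteq> 0"
      and "\<And>l. C l \<in> carrier_mat p p" "\<And>l. B l \<in> carrier_mat p p" "D \<in> carrier_mat p p"
      and "\<And>l. F l \<in> carrier_mat p p" "R \<in> carrier_mat p p" "G \<in> carrier_mat p p"
      and "\<And>x. pmat_at G x * pmat_at (cpmat W) x =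
        pmat_at R x + msum p (\<lambda>l. C l * pmat_at (F l) x) {..<N}"
    for F R B C D G
    by (rule last_quasidet_eq [OF that(2) root_jet_carrier that(3,4) root_jet_carrier that(1)],
        rule root_jet_relation [OF W v that(5-7) that(2) that(8)])
  note at = biorth_poly_at [OF S(1)] biorth_poly_at [OF S(3)] biorth_poly_at [OF S(4)]
  \<comment> \<open>\<open>B\<close> and \<open>D\<close> stay free because the left block column
    alone determines the coefficients: the polynomials P1 give the first formula, and
    \<open>H k\<close> followed by zeros the second.\<close>
  have first: "last_quasidet (\<Pi>N k) (block_col p N B) (\<pi> (k + N)) D =
      D + msum p (\<lambda>l. C.\<omega> k (k + l) * B l) {..<N}"
    if "det (\<Pi>N k) \<noteq> 0" "\<And>l. B l \<in> carrier_mat p p" "D \<in> carrier_mat p p" for k B D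
    unfolding \<Pi>N_def \<pi>_def Pi_mat_def pi_mat_def
  proof (rule quasidet)
    show "pmat_at (cpmat (biorth_poly p S1' k)) x * pmat_at (cpmat W) x =
        pmat_at (?P (k + N)) x + msum p (\<lambda>l. C.\<omega> k (k + l) * pmat_at (?P (k + l)) x) {..<N}" for x
      unfolding at W_at by (rule C.P1'_W_band)
  qed (use that in \<open>simp_all add: \<Pi>N_def Pi_mat_def pi_mat_def\<close>)
  have "P1' k x * pmat_at (cpmat W) x =
      last_quasidet (\<Pi>N k) (block_col p N (\<lambda>l. P1 (k + l) x)) (\<pi> (k + N)) (P1 (k + N) x)"
    if "det (\<Pi>N k) \<noteq> 0" for k x
    by (subst first) (simp_all add: that P1_def P1'_def at W_at C.P1'_W_band)
  moreover have "cmat (H' k) = last_quasidet (\<Pi>N k)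
      (block_col p N (\<lambda>l. if l = 0 then cmat (H k) else 0\<^sub>m p p)) (\<pi> (k + N)) (0\<^sub>m p p)"
    if "det (\<Pi>N k) \<noteq> 0" for k
  proof -
    \<comment> \<open>Only \<open>l = 0\<close> survives, leaving the diagonal block of \<omega>
      times \<open>H k\<close>, which is the perturbed norm.\<close>
    have "msum p (\<lambda>l. C.\<omega> k (k + l) * (if l = 0 then cmat (H k) else 0\<^sub>m p p)) {..<N} =
        C.\<omega> k (k + 0) * (if 0 = (0::nat) then cmat (H k) else 0\<^sub>m p p)"
      using \<open>N \<ge> 1\<close> by (intro msum_single) (auto simp: C.zeros)
    then show ?thesis
      using H(3) by (subst first) (simp_all add: that C.omega_diag_H)
  qed
  moreover have "transpose_mat (P2' k y) * cmat (minv (H' k)) = last_quasidet (\<Pi>N (k + 1))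
      (block_col p N (\<lambda>l. if l = N - 1 then 1\<^sub>m p else 0\<^sub>m p p)) (\<gamma> k y) (0\<^sub>m p p)"
    if det: "det (\<Pi>N (k + 1)) \<noteq> 0" for k y
  proof -
    \<comment> \<open>For fixed \<open>y\<close>, \<open>?G\<close> is the perturbed kernel as a
      polynomial in x, and \<open>?C\<close> are the overlap coefficients of
      \<open>kernel_identity\<close>.\<close>
    let ?Q = "\<lambda>i. transpose_mat (pmat_at (cpmat (biorth_poly p S2' i)) y) * cmat (minv (H' i))"
    let ?C = "\<lambda>l. msum p (\<lambda>i. ?Q i * C.\<omega> i (k + 1 + l)) {..k}"
    let ?B = "\<lambda>l. if l = N - 1 then 1\<^sub>m p else 0\<^sub>m p p"
    let ?G = "msum p (\<lambda>i. map_mat (\<lambda>c. [:c:]) (?Q i) * cpmat (biorth_poly p S1' i)) {..k}"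
    have Q: "?Q i \<in> carrier_mat p p" for i
      unfolding at using inv'(1) by (intro mult_carrier_mat [of _ p p]) auto
    have "last_quasidet (\<Pi>N (k + 1)) (block_col p N ?B) (\<gamma> k y) (0\<^sub>m p p) =
        0\<^sub>m p p + msum p (\<lambda>l. ?C l * ?B l) {..<N}"
      unfolding \<Pi>N_def \<gamma>_def Pi_mat_def pi_mat_def gamma_mat_def
    proof (rule quasidet)
      fix x
      have "pmat_at ?G x = msum p (\<lambda>i. ?Q i * pmat_at (cpmat (biorth_poly p S1' i)) x) {..k}"
        by (simp add: pmat_at_mult [OF Q biorth_poly_carrier, symmetric])
          (unfold pmat_at_def, intro map_mat_msum mult_carrier_mat [of _ p p],
            use Q in \<open>auto simp: pmat_at_def\<close>)
      then show "pmat_at ?G x * pmat_at (cpmat W) x = pmat_at (CD_kernel p S1 H S2 k y) x +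
          msum p (\<lambda>l. ?C l * pmat_at (?P (k + 1 + l)) x) {..<N}"
        using C.kernel_identity(1) [OF \<open>N \<ge> 1\<close>]
        by (simp only: at W_at CD_kernel_at [OF S(1,2) inv(1)])
    qed (use det in \<open>simp_all add: \<Pi>N_def Pi_mat_def pi_mat_def\<close>)
    \<comment> \<open>The identity in the last block picks out the coefficient with index
      \<open>N - 1\<close>, the one known in closed form.\<close>
    also have "msum p (\<lambda>l. ?C l * ?B l) {..<N} = ?C (N - 1) * ?B (N - 1)"
      using \<open>N \<ge> 1\<close> by (intro msum_single) (auto simp: C.zeros)
    also have "?C (N - 1) = ?Q k"
      unfolding at by (rule C.kernel_identity(2) [OF \<open>N \<ge> 1\<close>])
    finally show ?thesis
      by (simp add: P2'_def right_mult_one_mat [OF Q] left_add_zero_mat [OF Q])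
  qed
  ultimately show ?thesis by blast
qed

end
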